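(* (a) For each integer $n\geq 12$ there exist $2$ distinct (i.e. pairwise non-isomorphic) $n$-vertex weakly regular triangulations of the torus. (b) For each integer $n\geq 18$ there exist $3$ distinct (i.e. pairwise non-isomorphic) $n$-vertex weakly regular triangulations of the torus. (c) For each integer $m\geq 2$ there exists a $(4m+2)$-vertex weakly regular triangulation of the Klein bottle.
   Context: A simplicial complex is a collection of non-empty finite sets such that every non-empty subset of an element is also an element; $V(X)$ is the vertex-set and $|X|$ the geometric carrier (geometric realization). $X$ is a triangulation of a space $P$ if $|X|$ is homeomorphic to $P$. An isomorphism $X\to Y$ of simplicial complexes is a bijection $V(X)\to V(Y)$ such that a subset of $V(X)$ is a simplex of $X$ if and only if its image is a simplex of $Y$; isomorphic complexes are identified. An automorphism is an isomorphism from a complex to itself. A triangulation of a connected closed surface is weakly regular if its automorphism group acts transitively on its vertices. *)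

theory Defs
  imports "HOL-Analysis.Analysis"
begin

section \<open>Abstract simplicial complexes\<close>

text \<open>The constant \<open>simplicial_complex\<close> of \<open>HOL-Analysis.Polytope\<close> denotes geometric complexes
  (sets of simplices in a Euclidean space); the complexes here are abstract.\<close>

definition abstract_complex :: "'a set set \<Rightarrow> bool" where
  "abstract_complex X \<longleftrightarrow>
     (\<forall>s\<in>X. finite s \<and> s \<noteq> {} \<and> (\<forall>t. t \<subseteq> s \<and> t \<noteq> {} \<longrightarrow> t \<in> X))"

definition vertices :: "'a set set \<Rightarrow> 'a set" where
  "vertices X = \<Union>X"

definition is_isomorphism :: "'a set set \<Rightarrow> 'b set set \<Rightarrow> ('a \<Rightarrow> 'b) \<Rightarrow> bool" where
  "is_isomorphism X Y f \<longleftrightarrow>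
     bij_betw f (vertices X) (vertices Y) \<and>
     (\<forall>s. s \<subseteq> vertices X \<longrightarrow> (s \<in> X \<longleftrightarrow> f ` s \<in> Y))"

definition isomorphic :: "'a set set \<Rightarrow> 'b set set \<Rightarrow> bool" where
  "isomorphic X Y \<longleftrightarrow> (\<exists>f. is_isomorphism X Y f)"

definition vertex_transitive :: "'a set set \<Rightarrow> bool" where
  "vertex_transitive X \<longleftrightarrow>
     (\<forall>u\<in>vertices X. \<forall>v\<in>vertices X. \<exists>f. is_isomorphism X X f \<and> f u = v)"

text \<open>Points are given by their barycentric coordinates. The carrier is topologised as a subspace
  of \<open>'a \<Rightarrow> real\<close> with the product topology; for finite complexes, the only ones used
  below, this agrees with the coherent (weak) topology.\<close>

definition geometric_carrier :: "'a set set \<Rightarrow> ('a \<Rightarrow> real) set" where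
  "geometric_carrier X =
     {x. (\<forall>v. 0 \<le> x v) \<and> {v. x v \<noteq> 0} \<in> X \<and> (\<Sum>v | x v \<noteq> 0. x v) = 1}"

definition triangulates :: "'a set set \<Rightarrow> 'b topology \<Rightarrow> bool" where
  "triangulates X P \<longleftrightarrow>
     abstract_complex X \<and> top_of_set (geometric_carrier X) homeomorphic_space P"

text \<open>For \<open>n > 0\<close> the condition on the cardinality includes finiteness of the vertex set.\<close>

definition weakly_regular_triangulation :: "'a set set \<Rightarrow> nat \<Rightarrow> 'b topology \<Rightarrow> bool" where
  "weakly_regular_triangulation X n P \<longleftrightarrow>
     triangulates X P \<and> card (vertices X) = n \<and> vertex_transitive X"


section \<open>Quotient spaces, the torus and the Klein bottle\<close>

definition quotient_topology :: "'a topology \<Rightarrow> ('a \<Rightarrow> 'b) \<Rightarrow> 'b topology" where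
  "quotient_topology T q =
     topology (\<lambda>U. U \<subseteq> q ` topspace T \<and> openin T {x \<in> topspace T. q x \<in> U})"

lemma openin_quotient_topology:
  "openin (quotient_topology T q) U \<longleftrightarrow>
     U \<subseteq> q ` topspace T \<and> openin T {x \<in> topspace T. q x \<in> U}"
proof -
  let ?P = "\<lambda>U. U \<subseteq> q ` topspace T \<and> openin T {x \<in> topspace T. q x \<in> U}"
  have int: "?P (U \<inter> V)" if "?P U" "?P V" for U V
  proof -
    have "{x \<in> topspace T. q x \<in> U \<inter> V} =
          {x \<in> topspace T. q x \<in> U} \<inter> {x \<in> topspace T. q x \<in> V}"
      by blast
    with that show ?thesis by auto
  qed
  have un: "?P (\<Union>K)" if "\<forall>U\<in>K. ?P U" for K
  proof -
    have "{x \<in> topspace T. q x \<in> \<Union>K} = (\<Union>U\<in>K. {x \<in> topspace T. q x \<in> U})"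
      by blast
    moreover have "openin T (\<Union>U\<in>K. {x \<in> topspace T. q x \<in> U})"
      using that by blast
    ultimately show ?thesis using that by auto
  qed
  have "istopology ?P"
    unfolding istopology_def using int un by blast
  then show ?thesis
    unfolding quotient_topology_def by (simp add: topology_inverse')
qed

lemma topspace_quotient_topology: "topspace (quotient_topology T q) = q ` topspace T"
proof
  show "topspace (quotient_topology T q) \<subseteq> q ` topspace T"
    by (meson openin_quotient_topology openin_topspace)
  have "{x \<in> topspace T. q x \<in> q ` topspace T} = topspace T"
    by blast
  then show "q ` topspace T \<subseteq> topspace (quotient_topology T q)"
    by (metis openin_quotient_topology openin_subset openin_topspace subset_refl)
qed

lemma quotient_map_quotient_topology: "quotient_map T (quotient_topology T q) q"
  unfolding quotient_map_def topspace_quotient_topology openin_quotient_topology by auto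

definition torus :: "(complex \<times> complex) topology" where
  "torus = prod_topology (top_of_set (sphere 0 1)) (top_of_set (sphere 0 1))"

text \<open>The Klein bottle is the unit square with \<open>(t, 0)\<close> glued to \<open>(t, 1)\<close> and \<open>(0, t)\<close> glued to
  \<open>(1, 1 - t)\<close>; its points are the classes of the generated equivalence relation.\<close>

definition klein_glue :: "real \<times> real \<Rightarrow> real \<times> real \<Rightarrow> bool" where
  "klein_glue p q \<longleftrightarrow>
     (\<exists>t\<in>{0..1}. p = (t, 0) \<and> q = (t, 1) \<or> p = (0, t) \<and> q = (1, 1 - t))"

definition klein_bottle :: "(real \<times> real) set topology" where
  "klein_bottle =
     quotient_topology (top_of_set ({0..1} \<times> {0..1})) (\<lambda>p. {q. equivclp klein_glue p q})"

end

theory Submission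
  imports Defs
begin

text \<open>Both surfaces are orbit spaces of the plane, and the triangulations come from the Kuhn
triangulation of the plane: unit squares with integer corners, each cut along its diagonal of
slope one, so that every vertex has degree six. Let a group of motions preserve this
triangulation, and suppose that two different lattice points of one vertex star are never in the
same orbit. If the lattice points are labelled by their orbits, the label sets of the triangles
generate an abstract complex whose carrier is the orbit space. The map from the plane to the
carrier is explicit: at a label \<open>v\<close> it takes the sum of the hat functions (the barycentric
coordinate functions of the triangulation) of all lattice points labelled \<open>v\<close>. Labels are
distinct on a star, so two points with the same image have, after a motion that makes a vertex of
their triangles coincide, the same barycentric coordinates; thus the fibres are exactly the orbits
(\<open>barycentric_map_eq_iff\<close>). Composed with a chart of a fundamental domain this is a quotient map
from the unit square, and the torus and the Klein bottle are quotients of the same square with the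
same fibres (\<open>geometric_carrier_homeomorphic\<close>).

For the torus, \<open>(i, j)\<close> is labelled \<open>i + k j\<close> modulo \<open>n\<close>; the group is a lattice of translations, the
star condition holds for \<open>n \<ge> 2 k + 3\<close>, and the shift \<open>i \<mapsto> i + 1\<close> acts on the labels as an
\<open>n\<close>-cycle. For the Klein bottle, the group is generated by the translation \<open>(i, j) \<mapsto> (i + 2, j + 4)\<close>,
orthogonal to the rows in the equilateral picture, and a glide reflection along the rows by half of
\<open>2 m + 1\<close>. It leaves two classes of rows with \<open>2 m + 1\<close> labels each. Shifts along the rows are
transitive on each class, and a point reflection exchanges the two.

To see that the tori differ, note that an isomorphism preserves the relation of being opposite in
the hexagonal link of a vertex. So it maps the straight path \<open>0, 1, 2, \<dots>\<close>, which meets every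
vertex, to a straight path, and is therefore of the form \<open>i \<mapsto> c + u i\<close>; the multiplier \<open>u\<close> takes
the six steps \<open>\<plusminus> 1, \<plusminus> k, \<plusminus> (k + 1)\<close> to the six steps of the other torus
(\<open>torus_isomorphism_multiplier\<close>). Comparing small residues excludes this for \<open>k = 2\<close> and
\<open>k = 3\<close> if \<open>n \<ge> 12\<close>, and for \<open>k = 4\<close> and either of them if \<open>n \<ge> 18\<close>, with one exception: modulo
19, multiplication by 5 takes \<open>1, 3, 4\<close> to \<open>5, -4, 1\<close>, so \<open>k = 3\<close> and \<open>k = 4\<close> give
isomorphic complexes. For \<open>n = 19\<close>, \<open>k = 7\<close> serves as the third torus.\<close>

section \<open>The Kuhn triangulation of the plane\<close>

definition kuhn_triangle :: "bool \<Rightarrow> int \<Rightarrow> int \<Rightarrow> (int \<times> int) set" where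
  "kuhn_triangle up i j = {(i, j), (if up then (i, j + 1) else (i + 1, j)), (i + 1, j + 1)}"

text \<open>The barycentric coordinate of \<open>p\<close> at the vertex \<open>q\<close>, extended by zero outside the star of \<open>q\<close>. The
unit ball of the norm in this formula is the hexagon formed by the six triangles at a vertex, and
the norm is affine on each of them.\<close>

definition hat :: "real \<times> real \<Rightarrow> int \<times> int \<Rightarrow> real" where
  "hat p q = (let s = fst p - of_int (fst q); t = snd p - of_int (snd q)
              in max 0 (1 - max (max \<bar>s\<bar> \<bar>t\<bar>) \<bar>s - t\<bar>))"

definition star :: "int \<times> int \<Rightarrow> (int \<times> int) set" where
  "star c = {q. let a = fst q - fst c; b = snd q - snd c in \<bar>a\<bar> \<le> 1 \<and> \<bar>b\<bar> \<le> 1 \<and> \<bar>a - b\<bar> \<le> 1}"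

lemma star_difference:
  assumes "q \<in> star c" "q' \<in> star c"
  shows "\<bar>fst q' - fst q\<bar> \<le> 2" "\<bar>snd q' - snd q\<bar> \<le> 2"
    "\<bar>(fst q' - fst q) - (snd q' - snd q)\<bar> \<le> 2"
  using assms unfolding star_def Let_def mem_Collect_eq by linarith+

lemma finite_kuhn_triangle [simp]: "finite (kuhn_triangle up i j)"
  by (simp add: kuhn_triangle_def)

lemma kuhn_triangle_subset_star:
  assumes "q \<in> kuhn_triangle up i j"
  shows "kuhn_triangle up i j \<subseteq> star q"
proof -
  have bounds: "i \<le> fst r \<and> fst r \<le> i + 1 \<and> j \<le> snd r \<and> snd r \<le> j + 1 \<and>
      (if up then fst r - i \<le> snd r - j else snd r - j \<le> fst r - i)"
    if "r \<in> kuhn_triangle up i j" for r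
    using that by (cases up) (auto simp: kuhn_triangle_def)
  show ?thesis
  proof
    fix r
    assume r: "r \<in> kuhn_triangle up i j"
    show "r \<in> star q"
      using bounds[OF r] bounds[OF assms] unfolding star_def Let_def mem_Collect_eq
      by (smt (verit))
  qed
qed

lemma self_in_star [simp]: "q \<in> star q"
  by (simp add: star_def)

lemma hat_nonneg [simp]: "0 \<le> hat p q"
  by (simp add: hat_def Let_def)

lemma abs_ge_1I: "\<bar>x - of_int m\<bar> \<ge> 1"
  if "0 \<le> x" "x \<le> (1::real)" "m < 0 \<or> m > 1"
proof -
  have "m \<le> -1 \<or> m \<ge> 2"
    using that(3) by linarith
  then have "of_int m \<le> (-1::real) \<or> of_int m \<ge> (2::real)"
    by (metis of_int_le_iff of_int_minus of_int_1 of_int_numeral)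
  then show ?thesis using that by linarith
qed

lemma hat_in_unit_cell:
  fixes s t :: real
  assumes "0 \<le> s" "s \<le> 1" "0 \<le> t" "t \<le> 1"
  shows "hat (of_int i + s, of_int j + t) (i + a, j + b) =
    (if a = 0 \<and> b = 0 then 1 - max s t
     else if a = 1 \<and> b = 0 then max 0 (s - t)
     else if a = 0 \<and> b = 1 then max 0 (t - s)
     else if a = 1 \<and> b = 1 then min s t
     else 0)"
proof -
  have *: "hat (of_int i + s, of_int j + t) (i + a, j + b) =
      max 0 (1 - max (max \<bar>s - of_int a\<bar> \<bar>t - of_int b\<bar>) \<bar>(s - of_int a) - (t - of_int b)\<bar>)"
    by (simp add: hat_def Let_def)
  show ?thesis
  proof (cases "a \<in> {0,1} \<and> b \<in> {0,1}")
    case True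
    then consider "a = 0 \<and> b = 0" | "a = 1 \<and> b = 0" | "a = 0 \<and> b = 1" | "a = 1 \<and> b = 1"
      by auto
    then show ?thesis
    proof cases
      case 1
      then have ab: "of_int a = (0::real)" "of_int b = (0::real)" by simp_all
      have "max (max \<bar>s - of_int a\<bar> \<bar>t - of_int b\<bar>) \<bar>(s - of_int a) - (t - of_int b)\<bar> = max s t"
        unfolding ab using assms by linarith
      then show ?thesis unfolding * using 1 assms by simp
    next
      case 2
      then have ab: "of_int a = (1::real)" "of_int b = (0::real)" by simp_all
      have "max (max \<bar>s - of_int a\<bar> \<bar>t - of_int b\<bar>) \<bar>(s - of_int a) - (t - of_int b)\<bar> = 1 - s + t"
        unfolding ab using assms by linarith
      then show ?thesis unfolding * using 2 assms by simp
    next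
      case 3
      then have ab: "of_int a = (0::real)" "of_int b = (1::real)" by simp_all
      have "max (max \<bar>s - of_int a\<bar> \<bar>t - of_int b\<bar>) \<bar>(s - of_int a) - (t - of_int b)\<bar> = 1 + s - t"
        unfolding ab using assms by linarith
      then show ?thesis unfolding * using 3 assms by simp
    next
      case 4
      then have ab: "of_int a = (1::real)" "of_int b = (1::real)" by simp_all
      have "max (max \<bar>s - of_int a\<bar> \<bar>t - of_int b\<bar>) \<bar>(s - of_int a) - (t - of_int b)\<bar> = 1 - min s t"
        unfolding ab using assms by linarith
      then show ?thesis unfolding * using 4 assms by simp
    qed
  next
    case False
    then have "\<bar>s - of_int a\<bar> \<ge> 1 \<or> \<bar>t - of_int b\<bar> \<ge> 1"
      using abs_ge_1I[of s a] abs_ge_1I[of t b] assms by auto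
    then have "1 - max (max \<bar>s - of_int a\<bar> \<bar>t - of_int b\<bar>) \<bar>(s - of_int a) - (t - of_int b)\<bar> \<le> 0"
      by linarith
    moreover have "\<not> (a = 0 \<and> b = 0)" "\<not> (a = 1 \<and> b = 0)" "\<not> (a = 0 \<and> b = 1)" "\<not> (a = 1 \<and> b = 1)"
      using False by auto
    ultimately show ?thesis
      unfolding * by (simp only: if_False max.absorb1)
  qed
qed

text \<open>Every system of barycentric weights on a triangle is the restriction of the hat functions at the
point it describes. This yields both the coordinates of a given point of the plane and, for the
surjectivity of the map to a carrier, a point with given coordinates.\<close>

lemma hat_barycentric:
  assumes w: "\<And>q. q \<in> kuhn_triangle up i j \<Longrightarrow> 0 \<le> w q" "sum w (kuhn_triangle up i j) = 1"
    and p: "fst p = (\<Sum>q\<in>kuhn_triangle up i j. w q * of_int (fst q))"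
      "snd p = (\<Sum>q\<in>kuhn_triangle up i j. w q * of_int (snd q))"
  shows "hat p q = (if q \<in> kuhn_triangle up i j then w q else 0)"
proof -
  define m where "m = (if up then (i, j + 1) else (i + 1, j))"
  have T: "kuhn_triangle up i j = {(i, j), m, (i + 1, j + 1)}"
    and d: "(i,j) \<noteq> m" "m \<noteq> (i + 1, j + 1)"
    by (auto simp: kuhn_triangle_def m_def)
  define x y z where "x = w (i, j)" and "y = w m" and "z = w (i + 1, j + 1)"
  have nn: "0 \<le> x" "0 \<le> y" "0 \<le> z" and one: "x = 1 - y - z"
    using w d by (auto simp: T x_def y_def z_def)
  define s t where "s = (if up then z else y + z)" and "t = (if up then y + z else z)"
  have st: "0 \<le> s" "s \<le> 1" "0 \<le> t" "t \<le> 1"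
    using nn one by (auto simp: s_def t_def)
  have "fst p = x * of_int i + y * of_int (fst m) + z * of_int (i + 1)"
    using d by (simp add: p T x_def y_def z_def)
  then have p1: "fst p = of_int i + s"
    by (auto simp: one m_def s_def algebra_simps)
  have "snd p = x * of_int j + y * of_int (snd m) + z * of_int (j + 1)"
    using d by (simp add: p T x_def y_def z_def)
  then have p2: "snd p = of_int j + t"
    by (auto simp: one m_def t_def algebra_simps)
  obtain a b where q: "q = (i + a, j + b)"
    by (metis add.commute diff_add_cancel prod.collapse)
  have "p = (of_int i + s, of_int j + t)"
    using p1 p2 by (simp add: prod_eq_iff)
  then have hat: "hat p q = (if a = 0 \<and> b = 0 then 1 - max s t
     else if a = 1 \<and> b = 0 then max 0 (s - t)
     else if a = 0 \<and> b = 1 then max 0 (t - s)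
     else if a = 1 \<and> b = 1 then min s t
     else 0)"
    unfolding q using hat_in_unit_cell[OF st, of i j a b] by simp
  show ?thesis
  proof (cases up)
    case True
    then have "s = z" "t = y + z" "m = (i, j + 1)" by (simp_all add: s_def t_def m_def)
    then show ?thesis
      unfolding hat T unfolding q using nn one
      by (simp add: x_def y_def z_def)
  next
    case False
    then have "s = y + z" "t = z" "m = (i + 1, j)" by (simp_all add: s_def t_def m_def)
    then show ?thesis
      unfolding hat T unfolding q using nn one
      by (simp add: x_def y_def z_def)
  qed
qed

lemma barycentric_exists:
  "\<exists>up i j. (\<forall>q. q \<notin> kuhn_triangle up i j \<longrightarrow> hat p q = 0) \<and>
    (\<Sum>q\<in>kuhn_triangle up i j. hat p q) = 1 \<and>
    fst p = (\<Sum>q\<in>kuhn_triangle up i j. hat p q * of_int (fst q)) \<and>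
    snd p = (\<Sum>q\<in>kuhn_triangle up i j. hat p q * of_int (snd q))"
proof -
  define i j where "i = \<lfloor>fst p\<rfloor>" and "j = \<lfloor>snd p\<rfloor>"
  define s t where "s = frac (fst p)" and "t = frac (snd p)"
  have st: "0 \<le> s" "s \<le> 1" "0 \<le> t" "t \<le> 1"
    using frac_lt_1[of "fst p"] frac_lt_1[of "snd p"] by (auto simp: s_def t_def less_imp_le)
  have p: "fst p = of_int i + s" "snd p = of_int j + t"
    by (simp_all add: i_def j_def s_def t_def frac_def)
  define up where "up = (s < t)"
  define m where "m = (if up then (i, j + 1) else (i + 1, j))"
  define w where "w q = (if q = (i, j) then 1 - max s t else if q = m then \<bar>s - t\<bar> else min s t)" for q
  have T: "kuhn_triangle up i j = {(i, j), m, (i + 1, j + 1)}"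
    and d: "(i,j) \<noteq> m" "m \<noteq> (i + 1, j + 1)"
    by (auto simp: kuhn_triangle_def m_def)
  have w1: "sum w (kuhn_triangle up i j) = 1" and w0: "\<And>q. 0 \<le> w q"
    using d st by (auto simp: T w_def max_def min_def)
  have p1: "fst p = (\<Sum>q\<in>kuhn_triangle up i j. w q * of_int (fst q))"
    and p2: "snd p = (\<Sum>q\<in>kuhn_triangle up i j. w q * of_int (snd q))"
    using d unfolding T p by (auto simp: w_def m_def up_def max_def min_def algebra_simps)
  have hat: "hat p q = (if q \<in> kuhn_triangle up i j then w q else 0)" for q
    by (rule hat_barycentric[OF w0 w1 p1 p2])
  show ?thesis
    by (intro exI[of _ up] exI[of _ i] exI[of _ j]) (use hat w1 p1 p2 in auto)
qed

definition carrier_simplex :: "real \<times> real \<Rightarrow> (int \<times> int) set" where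
  "carrier_simplex p = {q. hat p q \<noteq> 0}"

lemma carrier_simplex_subset_triangle:
  obtains up i j where "carrier_simplex p \<subseteq> kuhn_triangle up i j"
proof -
  obtain up i j where "\<forall>q. q \<notin> kuhn_triangle up i j \<longrightarrow> hat p q = 0"
    using barycentric_exists[of p] by blast
  then have "carrier_simplex p \<subseteq> kuhn_triangle up i j"
    by (auto simp: carrier_simplex_def)
  then show thesis by (rule that)
qed

lemma finite_carrier_simplex [simp]: "finite (carrier_simplex p)"
  by (rule carrier_simplex_subset_triangle[of p]) (rule finite_subset, auto)

lemma carrier_simplex_subset_star: "q \<in> carrier_simplex p \<Longrightarrow> carrier_simplex p \<subseteq> star q"
  by (rule carrier_simplex_subset_triangle[of p]) (use kuhn_triangle_subset_star in blast)

lemma sum_hat: "(\<Sum>q\<in>carrier_simplex p. hat p q) = 1"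
  and sum_hat_fst: "(\<Sum>q\<in>carrier_simplex p. hat p q * of_int (fst q)) = fst p"
  and sum_hat_snd: "(\<Sum>q\<in>carrier_simplex p. hat p q * of_int (snd q)) = snd p"
proof -
  obtain up i j where T: "\<forall>q. q \<notin> kuhn_triangle up i j \<longrightarrow> hat p q = 0"
    "(\<Sum>q\<in>kuhn_triangle up i j. hat p q) = 1"
    "fst p = (\<Sum>q\<in>kuhn_triangle up i j. hat p q * of_int (fst q))"
    "snd p = (\<Sum>q\<in>kuhn_triangle up i j. hat p q * of_int (snd q))"
    using barycentric_exists[of p] by blast
  have eq: "(\<Sum>q\<in>carrier_simplex p. hat p q * f q) = (\<Sum>q\<in>kuhn_triangle up i j. hat p q * f q)" for f
    by (rule sum.mono_neutral_left) (use T(1) in \<open>auto simp: carrier_simplex_def\<close>)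
  show "(\<Sum>q\<in>carrier_simplex p. hat p q) = 1"
    using eq[of "\<lambda>_. 1"] T(2) by simp
  show "(\<Sum>q\<in>carrier_simplex p. hat p q * of_int (fst q)) = fst p"
    "(\<Sum>q\<in>carrier_simplex p. hat p q * of_int (snd q)) = snd p"
    unfolding eq T(3,4) by (rule refl)+
qed

text \<open>A point is the barycentre of the lattice points with its hat values as weights.\<close>

lemma hat_eq_imp_eq: "p = p'" if "hat p = hat p'"
proof -
  have "carrier_simplex p = carrier_simplex p'"
    using that by (simp add: carrier_simplex_def)
  then show ?thesis
    using that sum_hat_fst[of p] sum_hat_fst[of p'] sum_hat_snd[of p] sum_hat_snd[of p']
    by (simp add: prod_eq_iff)
qed

section \<open>Lattice motions\<close>

text \<open>Translations and glide reflections in lattice coordinates. The linear part \<open>(x, y) \<mapsto> (x - y, - y)\<close>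
fixes \<open>(1, 0)\<close> and exchanges the two other edge directions up to sign: in coordinates that make
the triangles equilateral it is the reflection in a row. Stating it over a ring lets the same triple
act on lattice points and on points of the plane.\<close>

fun motion :: "bool \<times> int \<times> int \<Rightarrow> 'a::ring_1 \<times> 'a \<Rightarrow> 'a \<times> 'a" where
  "motion (glide, a, b) (x, y) =
     (if glide then (x - y + of_int a, of_int b - y) else (x + of_int a, y + of_int b))"

lemma hat_motion: "hat (motion g p) (motion g q) = hat p q"
proof -
  obtain e a b where g: "g = (e, a, b)" by (cases g)
  obtain x y where p: "p = (x, y)" by (cases p)
  obtain i j where q: "q = (i, j)" by (cases q)
  have "hat (motion (True, a, b) (x, y)) (motion (True, a, b) (i, j)) = hat (x, y) (i, j)"
  proof -
    define s t where "s = x - of_int i" and "t = y - of_int j"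
    have "x - y + of_int a - of_int (i - j + a) = s - t" "of_int b - y - of_int (b - j) = - t"
      by (simp_all add: s_def t_def)
    then show ?thesis
      unfolding hat_def Let_def motion.simps fst_conv snd_conv if_True
      by (simp add: s_def[symmetric] t_def[symmetric] max.commute max.left_commute)
  qed
  moreover have "hat (motion (False, a, b) (x, y)) (motion (False, a, b) (i, j)) = hat (x, y) (i, j)"
    by (simp add: hat_def Let_def)
  ultimately show ?thesis by (cases e) (auto simp: g p q)
qed

lemma bij_motion: "bij (motion g :: int \<times> int \<Rightarrow> int \<times> int)"
proof -
  obtain e a b where g: "g = (e, a, b)" by (cases g)
  define h :: "int \<times> int \<Rightarrow> int \<times> int" where
    "h q = (if e then (fst q - a + b - snd q, b - snd q) else (fst q - a, snd q - b))" for q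
  have "motion g (h q) = q" "h (motion g q) = q" for q
    by (cases q; cases e; simp add: g h_def)+
  then show ?thesis by (metis bijI' )
qed

section \<open>Quotients of the triangulation by groups of motions\<close>

definition label_complex :: "(int \<times> int \<Rightarrow> 'v) \<Rightarrow> 'v set set" where
  "label_complex lab = {s. s \<noteq> {} \<and> (\<exists>up i j. s \<subseteq> lab ` kuhn_triangle up i j)}"

lemma label_complexI:
  assumes "s \<noteq> {}" "s \<subseteq> lab ` kuhn_triangle up i j"
  shows "s \<in> label_complex lab"
  unfolding label_complex_def mem_Collect_eq using assms by (intro conjI exI)

lemma abstract_complex_label_complex: "abstract_complex (label_complex lab)"
  unfolding abstract_complex_def
proof (intro ballI conjI allI impI)
  fix s
  assume "s \<in> label_complex lab"
  then obtain up i j where s: "s \<noteq> {}" "s \<subseteq> lab ` kuhn_triangle up i j"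
    by (auto simp: label_complex_def)
  show "s \<noteq> {}" by (rule s)
  show "finite s"
    using s(2) by (rule finite_subset) simp
  fix t
  assume "t \<subseteq> s \<and> t \<noteq> {}"
  then show "t \<in> label_complex lab"
    using s(2) by (intro label_complexI[of t lab up i j]) auto
qed

lemma vertices_label_complex: "vertices (label_complex lab) = range lab"
proof
  show "vertices (label_complex lab) \<subseteq> range lab"
    by (auto simp: vertices_def label_complex_def)
  have "{lab (i, j)} \<in> label_complex lab" for i j
    by (rule label_complexI[of _ _ True i j]) (auto simp: kuhn_triangle_def)
  then show "range lab \<subseteq> vertices (label_complex lab)"
    unfolding vertices_def by (auto intro!: UnionI)
qed

text \<open>For a finite complex it suffices that simplices go to simplices: a permutation of the vertices
induces an injective map from the finite set of simplices to itself, hence a bijection.\<close>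

lemma isomorphism_of_simplicial_permutation:
  assumes X: "abstract_complex X" and fin: "finite (vertices X)"
    and f: "f ` vertices X = vertices X" and simplex: "\<And>s. s \<in> X \<Longrightarrow> f ` s \<in> X"
  shows "is_isomorphism X X f"
  unfolding is_isomorphism_def
proof (intro conjI allI impI)
  have inj: "inj_on f (vertices X)"
    using fin f by (simp add: eq_card_imp_inj_on)
  then show "bij_betw f (vertices X) (vertices X)"
    using f by (simp add: bij_betw_def)
  have sub: "s \<subseteq> vertices X" if "s \<in> X" for s
    using that by (auto simp: vertices_def)
  have "finite X"
    using sub fin by (metis Pow_iff finite_Pow_iff finite_subset subsetI)
  moreover have "inj_on ((`) f) X"
    using inj sub by (metis inj_on_image_eq_iff inj_onI)
  moreover have "(`) f ` X \<subseteq> X"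
    using simplex by auto
  ultimately have onto: "(`) f ` X = X"
    by (simp add: endo_inj_surj)
  fix s
  assume s: "s \<subseteq> vertices X"
  show "s \<in> X \<longleftrightarrow> f ` s \<in> X"
  proof
    assume "f ` s \<in> X"
    then obtain t where "t \<in> X" "f ` t = f ` s"
      using onto by (metis image_iff)
    then show "s \<in> X"
      using inj s sub by (metis inj_on_image_eq_iff)
  qed (rule simplex)
qed

text \<open>A symmetry of the triangulated plane descends to the labels as soon as it respects equality of
labels. All automorphisms used for vertex transitivity are obtained in this way.\<close>

lemma label_complex_automorphism:
  assumes fin: "finite (range lab)" and "surj h"
    and tri: "\<And>up i j. \<exists>up' i' j'. h ` kuhn_triangle up i j \<subseteq> kuhn_triangle up' i' j'"
    and resp: "\<And>q q'. lab q = lab q' \<Longrightarrow> lab (h q) = lab (h q')"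
  shows "\<exists>f. is_isomorphism (label_complex lab) (label_complex lab) f \<and> (\<forall>q. f (lab q) = lab (h q))"
proof -
  define f where "f v = lab (h (inv lab v))" for v
  have f: "f (lab q) = lab (h q)" for q
    unfolding f_def by (rule resp) (simp add: f_inv_into_f)
  have "is_isomorphism (label_complex lab) (label_complex lab) f"
  proof (rule isomorphism_of_simplicial_permutation)
    have "f ` range lab = lab ` range h"
      by (simp only: image_image f)
    then show "f ` vertices (label_complex lab) = vertices (label_complex lab)"
      using \<open>surj h\<close> by (simp add: vertices_label_complex)
    fix s
    assume "s \<in> label_complex lab"
    then obtain up i j where s: "s \<noteq> {}" "s \<subseteq> lab ` kuhn_triangle up i j"
      by (auto simp: label_complex_def)
    obtain up' i' j' where "h ` kuhn_triangle up i j \<subseteq> kuhn_triangle up' i' j'"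
      using tri by blast
    moreover have "f ` s \<subseteq> lab ` h ` kuhn_triangle up i j"
      using s(2) f by auto
    ultimately have "f ` s \<subseteq> lab ` kuhn_triangle up' i' j'"
      by blast
    then show "f ` s \<in> label_complex lab"
      using s(1) by (intro label_complexI) auto
  qed (use fin in \<open>simp_all add: abstract_complex_label_complex vertices_label_complex\<close>)
  then show ?thesis using f by blast
qed

lemma label_complex_translation:
  assumes "finite (range lab)"
    and "\<And>i j i' j'. lab (i, j) = lab (i', j') \<Longrightarrow> lab (i + c, j + d) = lab (i' + c, j' + d)"
  shows "\<exists>f. is_isomorphism (label_complex lab) (label_complex lab) f \<and>
    (\<forall>i j. f (lab (i, j)) = lab (i + c, j + d))"
proof -
  define h where "h q = (fst q + c, snd q + d)" for q :: "int \<times> int"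
  have "\<exists>f. is_isomorphism (label_complex lab) (label_complex lab) f \<and> (\<forall>q. f (lab q) = lab (h q))"
  proof (rule label_complex_automorphism)
    have "h (i - c, j - d) = (i, j)" for i j by (simp add: h_def)
    then show "surj h" by (metis surjI surj_pair surj_def)
    have "h ` kuhn_triangle up i j \<subseteq> kuhn_triangle up (i + c) (j + d)" for up i j
      by (auto simp: kuhn_triangle_def h_def)
    then show "\<exists>up' i' j'. h ` kuhn_triangle up i j \<subseteq> kuhn_triangle up' i' j'" for up i j
      by blast
    show "lab (h q) = lab (h q')" if "lab q = lab q'" for q q'
      using assms(2)[of "fst q" "snd q" "fst q'" "snd q'"] that by (simp add: h_def)
  qed (rule assms(1))
  then show ?thesis by (simp add: h_def)
qed

lemma label_complex_point_reflection:
  assumes "finite (range lab)"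
    and "\<And>i j i' j'. lab (i, j) = lab (i', j') \<Longrightarrow> lab (c - i, d - j) = lab (c - i', d - j')"
  shows "\<exists>f. is_isomorphism (label_complex lab) (label_complex lab) f \<and>
    (\<forall>i j. f (lab (i, j)) = lab (c - i, d - j))"
proof -
  define h where "h q = (c - fst q, d - snd q)" for q :: "int \<times> int"
  have "\<exists>f. is_isomorphism (label_complex lab) (label_complex lab) f \<and> (\<forall>q. f (lab q) = lab (h q))"
  proof (rule label_complex_automorphism)
    have "h (c - i, d - j) = (i, j)" for i j by (simp add: h_def)
    then show "surj h" by (metis surjI surj_pair surj_def)
    have "h ` kuhn_triangle up i j \<subseteq> kuhn_triangle (\<not> up) (c - i - 1) (d - j - 1)" for up i j
      by (auto simp: kuhn_triangle_def h_def)
    then show "\<exists>up' i' j'. h ` kuhn_triangle up i j \<subseteq> kuhn_triangle up' i' j'" for up i j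
      by blast
    show "lab (h q) = lab (h q')" if "lab q = lab q'" for q q'
      using assms(2)[of "fst q" "snd q" "fst q'" "snd q'"] that by (simp add: h_def)
  qed (rule assms(1))
  then show ?thesis by (simp add: h_def)
qed

text \<open>The projection from the plane to the carrier of the complex of labels. The support condition only
makes the sum finite.\<close>

definition barycentric_map :: "(int \<times> int \<Rightarrow> 'v) \<Rightarrow> real \<times> real \<Rightarrow> 'v \<Rightarrow> real" where
  "barycentric_map lab p v = (\<Sum>q | q \<in> carrier_simplex p \<and> lab q = v. hat p q)"

lemma barycentric_map_eq_sum:
  assumes "finite S" "carrier_simplex p \<subseteq> S"
  shows "barycentric_map lab p v = (\<Sum>q\<in>S. if lab q = v then hat p q else 0)"
proof -
  have "(\<Sum>q\<in>S. if lab q = v then hat p q else 0) = (\<Sum>q | q \<in> S \<and> lab q = v. hat p q)"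
    using assms(1) by (simp add: sum.inter_filter)
  also have "\<dots> = barycentric_map lab p v"
    unfolding barycentric_map_def
    by (rule sum.mono_neutral_right) (use assms in \<open>auto simp: carrier_simplex_def\<close>)
  finally show ?thesis ..
qed

lemma continuous_on_hat: "continuous_on S (\<lambda>p. hat p q)"
  unfolding hat_def Let_def
  by (intro continuous_intros)

lemma continuous_on_barycentric_map:
  assumes "bounded S"
  shows "continuous_on S (barycentric_map lab)"
proof (rule continuous_on_coordinatewise_then_product)
  fix v
  obtain B where B: "\<And>p. p \<in> S \<Longrightarrow> norm p \<le> B"
    using assms by (auto simp: bounded_iff)
  \<comment> \<open>Only lattice points in a box around \<open>S\<close> contribute, so one finite sum serves all of \<open>S\<close>.\<close>
  define Q where "Q = {- \<lceil>B\<rceil> - 1 .. \<lceil>B\<rceil> + 1} \<times> {- \<lceil>B\<rceil> - 1 .. \<lceil>B\<rceil> + 1}"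
  have Q: "carrier_simplex p \<subseteq> Q" if "p \<in> S" for p
  proof
    fix q
    assume "q \<in> carrier_simplex p"
    then have "\<bar>fst p - of_int (fst q)\<bar> \<le> 1" "\<bar>snd p - of_int (snd q)\<bar> \<le> 1"
      by (auto simp: carrier_simplex_def hat_def Let_def)
    moreover have "\<bar>fst p\<bar> \<le> B" "\<bar>snd p\<bar> \<le> B"
      using B[OF that] norm_fst_le[of "fst p" "snd p"] norm_snd_le[of "snd p" "fst p"] by auto
    ultimately have "\<bar>real_of_int (fst q)\<bar> \<le> B + 1" "\<bar>real_of_int (snd q)\<bar> \<le> B + 1"
      by linarith+
    then show "q \<in> Q"
      unfolding Q_def mem_Times_iff by simp linarith
  qed
  have "continuous_on S (\<lambda>p. \<Sum>q\<in>Q. if lab q = v then hat p q else 0)"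
  proof (intro continuous_on_sum)
    show "continuous_on S (\<lambda>p. if lab q = v then hat p q else 0)" for q
      by (cases "lab q = v") (simp_all add: continuous_on_hat)
  qed
  then show "continuous_on S (\<lambda>p. barycentric_map lab p v)"
    using Q by (subst continuous_on_cong[OF refl barycentric_map_eq_sum[where S = Q]]) (auto simp: Q_def)
qed

text \<open>Each of the two maps factors through the other, and the factors are inverse to each other.\<close>

lemma homeomorphic_spaceI_quotient_maps:
  assumes f: "quotient_map X Y f" and g: "quotient_map X Z g"
    and fibres: "\<And>x y. x \<in> topspace X \<Longrightarrow> y \<in> topspace X \<Longrightarrow> f x = f y \<longleftrightarrow> g x = g y"
  shows "Y homeomorphic_space Z"
proof -
  obtain h where h: "continuous_map Y Z h" "\<And>x. x \<in> topspace X \<Longrightarrow> h (f x) = g x"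
    using quotient_map_lift_exists[OF f quotient_imp_continuous_map[OF g]] fibres by metis
  obtain k where k: "continuous_map Z Y k" "\<And>x. x \<in> topspace X \<Longrightarrow> k (g x) = f x"
    using quotient_map_lift_exists[OF g quotient_imp_continuous_map[OF f]] fibres by metis
  have "homeomorphic_maps Y Z h k"
    unfolding homeomorphic_maps_def
    using h k quotient_imp_surjective_map[OF f] quotient_imp_surjective_map[OF g]
    by (auto simp: image_iff) (metis imageE)+
  then show ?thesis
    unfolding homeomorphic_space_def by blast
qed

abbreviation unit_square :: "(real \<times> real) set" where
  "unit_square \<equiv> {0..1} \<times> {0..1}"

lemma Hausdorff_space_fun_real: "Hausdorff_space (euclidean :: ('v \<Rightarrow> real) topology)"
  unfolding euclidean_product_topology[symmetric] Hausdorff_space_product_topology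
  by simp

text \<open>The labels name the orbits of \<open>G\<close> on the lattice points, and no star contains two points of one
orbit. The second condition makes the projection injective on every star, so that triangles
remain triangles in the quotient.\<close>

locale motion_quotient =
  fixes lab :: "int \<times> int \<Rightarrow> 'v" and G :: "(bool \<times> int \<times> int) set"
  assumes label_eq_iff: "lab q = lab q' \<longleftrightarrow> (\<exists>g\<in>G. motion g q = q')"
    and star_separated: "g \<in> G \<Longrightarrow> q \<in> star c \<Longrightarrow> motion g q \<in> star c \<Longrightarrow> motion g q = q"
begin

lemma inj_on_star: "inj_on lab (star c)"
proof (rule inj_onI)
  fix q q'
  assume q: "q \<in> star c" "q' \<in> star c" and "lab q = lab q'"
  then obtain g where "g \<in> G" "motion g q = q'"
    using label_eq_iff by blast
  with q star_separated[of g q c] show "q = q'" by simp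
qed

text \<open>If \<open>c\<close> is a vertex of the simplex that contains \<open>p\<close>, then all lattice points with nonzero hat value
at \<open>p\<close> lie in the star of \<open>c\<close>, where labels are distinct; so no two hat values are added up.\<close>

lemma barycentric_map_at_label:
  assumes "c \<in> carrier_simplex p" "q \<in> star c"
  shows "barycentric_map lab p (lab q) = hat p q"
proof -
  have "{r. r \<in> carrier_simplex p \<and> lab r = lab q} = (if q \<in> carrier_simplex p then {q} else {})"
    using inj_on_star[of c] carrier_simplex_subset_star[OF assms(1)] assms(2)
    by (auto dest: inj_onD)
  then show ?thesis
    unfolding barycentric_map_def by (simp add: carrier_simplex_def)
qed

lemma barycentric_map_nonneg: "0 \<le> barycentric_map lab p v"
  unfolding barycentric_map_def by (simp add: sum_nonneg)

lemma barycentric_map_outside: "v \<notin> lab ` carrier_simplex p \<Longrightarrow> barycentric_map lab p v = 0"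
  unfolding barycentric_map_def by (rule sum.neutral) auto

lemma barycentric_map_at_carrier: "q \<in> carrier_simplex p \<Longrightarrow> barycentric_map lab p (lab q) = hat p q"
  by (rule barycentric_map_at_label[of q]) auto

lemma support_barycentric_map: "{v. barycentric_map lab p v \<noteq> 0} = lab ` carrier_simplex p"
proof -
  have "barycentric_map lab p (lab q) \<noteq> 0" if "q \<in> carrier_simplex p" for q
    using barycentric_map_at_carrier[OF that] that by (simp add: carrier_simplex_def)
  then show ?thesis using barycentric_map_outside by blast
qed

lemma carrier_simplex_nonempty: "carrier_simplex p \<noteq> {}"
  using sum_hat[of p] by auto

lemma barycentric_map_in_carrier: "barycentric_map lab p \<in> geometric_carrier (label_complex lab)"
  unfolding geometric_carrier_def mem_Collect_eq support_barycentric_map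
proof (intro conjI allI barycentric_map_nonneg)
  obtain up i j where T: "carrier_simplex p \<subseteq> kuhn_triangle up i j"
    by (rule carrier_simplex_subset_triangle)
  show "lab ` carrier_simplex p \<in> label_complex lab"
    by (rule label_complexI[OF _ image_mono[OF T]]) (simp add: carrier_simplex_nonempty)
  obtain c where "c \<in> carrier_simplex p"
    using carrier_simplex_nonempty[of p] by blast
  then have "inj_on lab (carrier_simplex p)"
    by (rule inj_on_subset[OF inj_on_star carrier_simplex_subset_star])
  then have "sum (barycentric_map lab p) (lab ` carrier_simplex p) = (\<Sum>q\<in>carrier_simplex p. hat p q)"
    by (simp add: sum.reindex barycentric_map_at_carrier)
  then show "sum (barycentric_map lab p) (lab ` carrier_simplex p) = 1"
    by (simp add: sum_hat)
qed

lemma barycentric_map_onto: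
  assumes "x \<in> geometric_carrier (label_complex lab)"
  obtains p where "barycentric_map lab p = x"
proof -
  from assms obtain up i j where nn: "\<And>v. 0 \<le> x v" and one: "(\<Sum>v | x v \<noteq> 0. x v) = 1"
    and supp: "{v. x v \<noteq> 0} \<subseteq> lab ` kuhn_triangle up i j"
    by (auto simp: geometric_carrier_def label_complex_def)
  define T where "T = kuhn_triangle up i j"
  have inj: "inj_on lab T"
  proof -
    have "(i, j) \<in> T" by (simp add: T_def kuhn_triangle_def)
    then show ?thesis
      unfolding T_def by (rule inj_on_subset[OF inj_on_star kuhn_triangle_subset_star])
  qed
  have "(\<Sum>q\<in>T. x (lab q)) = sum x (lab ` T)"
    using inj by (simp add: sum.reindex)
  also have "\<dots> = (\<Sum>v | x v \<noteq> 0. x v)"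
    by (rule sum.mono_neutral_right) (use supp in \<open>auto simp: T_def\<close>)
  finally have sum1: "(\<Sum>q\<in>T. x (lab q)) = 1"
    by (simp add: one)
  define p where "p = ((\<Sum>q\<in>T. x (lab q) * of_int (fst q)), (\<Sum>q\<in>T. x (lab q) * of_int (snd q)))"
  have hat: "hat p q = (if q \<in> T then x (lab q) else 0)" for q
    unfolding T_def
    by (rule hat_barycentric) (use nn sum1 in \<open>simp_all add: p_def T_def\<close>)
  have "barycentric_map lab p v = x v" for v
  proof -
    have "barycentric_map lab p v = (\<Sum>q\<in>T. if lab q = v then hat p q else 0)"
      by (rule barycentric_map_eq_sum) (auto simp: T_def[symmetric] carrier_simplex_def hat, simp add: T_def)
    also have "\<dots> = (\<Sum>q\<in>T. if lab q = v then x v else 0)"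
      by (intro sum.cong) (auto simp: hat)
    also have "\<dots> = x v"
    proof (cases "v \<in> lab ` T")
      case True
      then obtain r where r: "r \<in> T" "v = lab r" by blast
      then have "(\<Sum>q\<in>T. if lab q = v then x v else 0) = (\<Sum>q\<in>T. if q = r then x v else 0)"
        using inj by (intro sum.cong) (auto dest: inj_onD)
      also have "\<dots> = x v" using r(1) by (simp add: T_def)
      finally show ?thesis .
    next
      case False
      then have "x v = 0" using supp by (auto simp: T_def)
      then show ?thesis by (intro sum.neutral[THEN trans]) auto
    qed
    finally show ?thesis .
  qed
  then have "barycentric_map lab p = x" by blast
  then show thesis by (rule that)
qed

lemma barycentric_map_motion:
  assumes "g \<in> G"
  shows "barycentric_map lab (motion g p) = barycentric_map lab p"
proof
  fix v
  have inj: "inj (motion g :: int \<times> int \<Rightarrow> int \<times> int)" and surj: "surj (motion g :: int \<times> int \<Rightarrow> int \<times> int)"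
    using bij_motion by (auto simp: bij_def)
  have lab: "lab (motion g q) = lab q" for q
    using label_eq_iff assms by metis
  have "{q. q \<in> carrier_simplex (motion g p) \<and> lab q = v}
      = motion g ` {q. q \<in> carrier_simplex p \<and> lab q = v}"
  proof (intro subset_antisym subsetI)
    fix q
    assume q: "q \<in> {q. q \<in> carrier_simplex (motion g p) \<and> lab q = v}"
    obtain r where r: "q = motion g r" using surj by (metis surjD)
    have "r \<in> {q. q \<in> carrier_simplex p \<and> lab q = v}"
      using q by (simp add: carrier_simplex_def r hat_motion lab)
    then show "q \<in> motion g ` {q. q \<in> carrier_simplex p \<and> lab q = v}"
      using r by blast
  qed (auto simp: carrier_simplex_def hat_motion lab)
  then show "barycentric_map lab (motion g p) v = barycentric_map lab p v"
    unfolding barycentric_map_def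
    by (simp add: sum.reindex inj_on_subset[OF inj] hat_motion)
qed

text \<open>The fibres are the orbits. If two points have the same image, their carrier simplices have vertices
with a common label; after a motion they share a vertex \<open>c\<close>. Both points then have their nonzero
hat values on the star of \<open>c\<close>, where the image determines them.\<close>

lemma barycentric_map_eq_iff:
  "barycentric_map lab p = barycentric_map lab p' \<longleftrightarrow> (\<exists>g\<in>G. motion g p = p')"
proof
  assume eq: "barycentric_map lab p = barycentric_map lab p'"
  obtain q where q: "q \<in> carrier_simplex p"
    using carrier_simplex_nonempty[of p] by blast
  then have "lab q \<in> lab ` carrier_simplex p'"
    using eq by (metis imageI support_barycentric_map)
  then obtain c where c: "c \<in> carrier_simplex p'" "lab q = lab c" by blast
  then obtain g where g: "g \<in> G" "motion g q = c"
    using label_eq_iff by metis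
  have cg: "c \<in> carrier_simplex (motion g p)"
    using q by (simp add: carrier_simplex_def hat_motion flip: g(2))
  have "hat (motion g p) r = hat p' r" for r
  proof (cases "r \<in> star c")
    case True
    then show ?thesis
      using barycentric_map_at_label[OF cg True] barycentric_map_at_label[OF c(1) True]
        barycentric_map_motion[OF g(1)] eq by metis
  next
    case False
    then have "r \<notin> carrier_simplex (motion g p)" "r \<notin> carrier_simplex p'"
      using carrier_simplex_subset_star[OF cg] carrier_simplex_subset_star[OF c(1)] by blast+
    then show ?thesis by (simp add: carrier_simplex_def)
  qed
  then have "motion g p = p'"
    by (intro hat_eq_imp_eq) auto
  then show "\<exists>g\<in>G. motion g p = p'"
    using g(1) by blast
qed (use barycentric_map_motion in metis)

text \<open>The form in which the quotient is recognised: a chart \<open>\<Phi>\<close> of the unit square whose image meets every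
orbit, and a presentation \<open>\<psi>\<close> of the space \<open>P\<close> that identifies two points of the square exactly if
\<open>\<Phi>\<close> sends them to the same orbit. Compactness of the square makes the composite with the
barycentric map a quotient map.\<close>

lemma geometric_carrier_homeomorphic:
  fixes \<Phi> :: "real \<times> real \<Rightarrow> real \<times> real"
  assumes \<Phi>: "continuous_on unit_square \<Phi>"
    and cover: "\<And>p. \<exists>u\<in>unit_square. \<exists>g\<in>G. motion g (\<Phi> u) = p"
    and \<psi>: "quotient_map (top_of_set unit_square) P \<psi>"
    and fibres: "\<And>u u'. u \<in> unit_square \<Longrightarrow> u' \<in> unit_square \<Longrightarrow>
       \<psi> u = \<psi> u' \<longleftrightarrow> (\<exists>g\<in>G. motion g (\<Phi> u) = \<Phi> u')"
  shows "top_of_set (geometric_carrier (label_complex lab)) homeomorphic_space P"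
proof (rule homeomorphic_spaceI_quotient_maps[OF _ \<psi>])
  have compact: "compact unit_square"
    by (simp add: compact_Times)
  have onto: "(barycentric_map lab \<circ> \<Phi>) ` unit_square = geometric_carrier (label_complex lab)"
  proof (intro subset_antisym subsetI)
    fix x
    assume "x \<in> geometric_carrier (label_complex lab)"
    then obtain p where p: "barycentric_map lab p = x"
      by (rule barycentric_map_onto)
    obtain u g where "u \<in> unit_square" "g \<in> G" "motion g (\<Phi> u) = p"
      using cover by blast
    then show "x \<in> (barycentric_map lab \<circ> \<Phi>) ` unit_square"
      using barycentric_map_motion p by (metis comp_apply image_eqI)
  next
    fix x
    assume "x \<in> (barycentric_map lab \<circ> \<Phi>) ` unit_square"
    then obtain u where "x = barycentric_map lab (\<Phi> u)" by fastforce
    then show "x \<in> geometric_carrier (label_complex lab)"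
      by (simp only: barycentric_map_in_carrier)
  qed
  have "bounded (\<Phi> ` unit_square)"
    by (intro compact_imp_bounded compact_continuous_image \<Phi> compact)
  then have "continuous_on unit_square (barycentric_map lab \<circ> \<Phi>)"
    by (intro continuous_on_compose \<Phi> continuous_on_barycentric_map)
  then show "quotient_map (top_of_set unit_square) (top_of_set (geometric_carrier (label_complex lab)))
      (barycentric_map lab \<circ> \<Phi>)"
    using onto compact
    by (intro T1_Spaces.continuous_imp_quotient_map)
       (auto simp: continuous_map_in_subtopology compact_space_subtopology
         intro!: Hausdorff_space_subtopology Hausdorff_space_fun_real)
  show "(barycentric_map lab \<circ> \<Phi>) u = (barycentric_map lab \<circ> \<Phi>) u' \<longleftrightarrow> \<psi> u = \<psi> u'"
    if "u \<in> topspace (top_of_set unit_square)" "u' \<in> topspace (top_of_set unit_square)" for u u'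
    using that fibres by (simp add: barycentric_map_eq_iff)
qed

end

section \<open>Cyclic triangulations of the torus\<close>

lemma dvd_abs_less_imp_zero:
  fixes n x :: int
  assumes "n dvd x" "\<bar>x\<bar> < n"
  shows "x = 0"
proof (rule ccontr)
  assume "x \<noteq> 0"
  then have "\<bar>n\<bar> \<le> \<bar>x\<bar>" using assms(1) by (rule dvd_imp_le_int)
  then show False using assms(2) by linarith
qed

definition cyc :: "nat \<Rightarrow> int \<Rightarrow> nat" where
  "cyc n a = nat (a mod int n)"

lemma cyc_eq_iff: "0 < n \<Longrightarrow> cyc n a = cyc n b \<longleftrightarrow> int n dvd a - b"
  unfolding cyc_def by (simp add: eq_nat_nat_iff mod_eq_dvd_iff)

lemma cyc_cong: "0 < n \<Longrightarrow> cyc n a = cyc n b \<Longrightarrow> x - y = a - b \<Longrightarrow> cyc n x = cyc n y"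
  by (simp add: cyc_eq_iff)

lemma range_cyc: "0 < n \<Longrightarrow> range (cyc n) = {..<n}"
proof
  assume n: "0 < n"
  show "range (cyc n) \<subseteq> {..<n}"
    using n by (auto simp: cyc_def nat_less_iff)
  have "a = cyc n (int a)" if "a < n" for a
    using that by (simp add: cyc_def)
  then show "{..<n} \<subseteq> range (cyc n)" by blast
qed

definition torus_label :: "nat \<Rightarrow> int \<Rightarrow> int \<times> int \<Rightarrow> nat" where
  "torus_label n k q = cyc n (fst q + k * snd q)"

definition torus_deck :: "nat \<Rightarrow> int \<Rightarrow> (bool \<times> int \<times> int) set" where
  "torus_deck n k = {(False, a, b) | a b. int n dvd a + k * b}"

definition torus_complex :: "nat \<Rightarrow> int \<Rightarrow> nat set set" where
  "torus_complex n k = label_complex (torus_label n k)"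

text \<open>Two points of one star differ by a vector with \<open>\<bar>a\<bar>, \<bar>b\<bar>, \<bar>a - b\<bar> \<le> 2\<close>. Then \<open>\<bar>a + k b\<bar> \<le> 2 k + 2 < n\<close>,
so if \<open>n\<close> divides \<open>a + k b\<close> it vanishes; as \<open>k \<ge> 2\<close>, this leaves only \<open>a = b = 0\<close>. The bound
\<open>\<bar>a - b\<bar> \<le> 2\<close> is what excludes \<open>(-2, 1)\<close> for \<open>k = 2\<close>.\<close>

lemma torus_motion_quotient:
  assumes k: "2 \<le> k" and n: "2 * k + 3 \<le> int n"
  shows "motion_quotient (torus_label n k) (torus_deck n k)"
proof
  have "0 < n" using k n by linarith
  fix q q' :: "int \<times> int"
  obtain i j i' j' where q: "q = (i, j)" "q' = (i', j')" by (cases q, cases q')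
  have "torus_label n k q = torus_label n k q' \<longleftrightarrow> int n dvd (i' - i) + k * (j' - j)"
    unfolding torus_label_def q using cyc_eq_iff[OF \<open>0 < n\<close>, of "i' + k * j'" "i + k * j"]
    by (auto simp: algebra_simps)
  also have "\<dots> \<longleftrightarrow> (\<exists>g\<in>torus_deck n k. motion g q = q')"
  proof
    assume "int n dvd (i' - i) + k * (j' - j)"
    then have "(False, i' - i, j' - j) \<in> torus_deck n k" by (simp add: torus_deck_def)
    moreover have "motion (False, i' - i, j' - j) q = q'" by (simp add: q)
    ultimately show "\<exists>g\<in>torus_deck n k. motion g q = q'" by blast
  next
    assume "\<exists>g\<in>torus_deck n k. motion g q = q'"
    then show "int n dvd (i' - i) + k * (j' - j)" by (auto simp: torus_deck_def q)
  qed
  finally show "torus_label n k q = torus_label n k q' \<longleftrightarrow> (\<exists>g\<in>torus_deck n k. motion g q = q')" .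
next
  fix g and q c :: "int \<times> int"
  assume g: "g \<in> torus_deck n k" and star: "q \<in> star c" "motion g q \<in> star c"
  obtain a b where ab: "g = (False, a, b)" "int n dvd a + k * b"
    using g by (auto simp: torus_deck_def)
  obtain i j where q: "q = (i, j)" by (cases q)
  have bounds: "\<bar>a\<bar> \<le> 2" "\<bar>b\<bar> \<le> 2" "\<bar>a - b\<bar> \<le> 2"
    using star_difference[OF star] by (simp_all add: ab q)
  have "\<bar>k * b\<bar> \<le> k * 2"
    unfolding abs_mult using bounds k by (intro mult_mono) auto
  then have "\<bar>a + k * b\<bar> < int n"
    using bounds n by linarith
  with ab(2) have zero: "a + k * b = 0"
    by (rule dvd_abs_less_imp_zero)
  have "b = 0"
  proof (rule ccontr)
    assume "b \<noteq> 0"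
    then have "b = -2 \<or> b = -1 \<or> b = 1 \<or> b = 2"
      using bounds(2) by linarith
    then show False
      using zero bounds(1,3) k by (elim disjE; hypsubst; linarith)
  qed
  then show "motion g q = q"
    using zero by (simp add: ab q)
qed

lemma cis_2pi_eq_iff: "cis (2 * pi * x) = cis (2 * pi * y) \<longleftrightarrow> (\<exists>m::int. y = x + of_int m)"
proof -
  have "cis (2 * pi * x) = cis (2 * pi * y) \<longleftrightarrow>
      sin (2 * pi * y) = sin (2 * pi * x) \<and> cos (2 * pi * y) = cos (2 * pi * x)"
    by (auto simp: complex_eq_iff)
  also have "\<dots> \<longleftrightarrow> (\<exists>m::int. 2 * pi * y = 2 * pi * x + 2 * pi * m)"
    by (rule sin_cos_eq_iff)
  also have "\<dots> \<longleftrightarrow> (\<exists>m::int. y = x + of_int m)"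
    by (simp flip: distrib_left)
  finally show ?thesis .
qed

lemma quotient_map_square_torus:
  "quotient_map (top_of_set unit_square) torus (\<lambda>u. (cis (2 * pi * fst u), cis (2 * pi * snd u)))"
proof (rule T1_Spaces.continuous_imp_quotient_map)
  have cont: "continuous_on unit_square (\<lambda>u. cis (2 * pi * fst u))"
    "continuous_on unit_square (\<lambda>u. cis (2 * pi * snd u))"
    unfolding cis_conv_exp by (intro continuous_intros)+
  then show "continuous_map (top_of_set unit_square) torus (\<lambda>u. (cis (2 * pi * fst u), cis (2 * pi * snd u)))"
    unfolding torus_def continuous_map_paired by (auto simp: continuous_map_in_subtopology)
  show "compact_space (top_of_set unit_square)"
    by (simp add: compact_space_subtopology compact_Times)
  show "Hausdorff_space torus"
    unfolding torus_def by (simp add: Hausdorff_space_prod_topology Hausdorff_space_subtopology)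
  have circle: "\<exists>x\<in>{0..1}. cis (2 * pi * x) = z" if "z \<in> sphere 0 1" for z
  proof -
    have "cis (Arg2pi z) = z"
      using that by (simp add: cis_conv_exp flip: complex_norm_eq_1_exp)
    then have "cis (2 * pi * (Arg2pi z / (2 * pi))) = z"
      by simp
    moreover have "Arg2pi z / (2 * pi) \<in> {0..1}"
      using Arg2pi[of z] by (simp add: field_simps)
    ultimately show ?thesis by blast
  qed
  show "(\<lambda>u. (cis (2 * pi * fst u), cis (2 * pi * snd u))) ` topspace (top_of_set unit_square) = topspace torus"
  proof (intro subset_antisym subsetI)
    fix z
    assume "z \<in> topspace torus"
    then have "fst z \<in> sphere 0 1" "snd z \<in> sphere 0 1"
      by (auto simp: torus_def)
    then obtain x y where "x \<in> {0..1}" "cis (2 * pi * x) = fst z" "y \<in> {0..1}" "cis (2 * pi * y) = snd z"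
      using circle by meson
    then show "z \<in> (\<lambda>u. (cis (2 * pi * fst u), cis (2 * pi * snd u))) ` topspace (top_of_set unit_square)"
      by (intro image_eqI[where x = "(x, y)"]) auto
  qed (auto simp: torus_def)
qed

lemma torus_complex_carrier:
  assumes k: "2 \<le> k" and n: "2 * k + 3 \<le> int n"
  shows "top_of_set (geometric_carrier (torus_complex n k)) homeomorphic_space torus"
proof -
  interpret motion_quotient "torus_label n k" "torus_deck n k"
    using assms by (rule torus_motion_quotient)
  have n0: "real n > 0" using k n by linarith
  \<comment> \<open>The chart carries the translations by \<open>(1, 0)\<close> and \<open>(0, 1)\<close> to the generators \<open>(n, 0)\<close> and
\<open>(- k, 1)\<close> of the lattice.\<close>
  define \<Phi> :: "real \<times> real \<Rightarrow> real \<times> real" where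
    "\<Phi> u = (real n * fst u - of_int k * snd u, snd u)" for u
  show ?thesis
    unfolding torus_complex_def
  proof (rule geometric_carrier_homeomorphic[OF _ _ quotient_map_square_torus])
    show "continuous_on unit_square \<Phi>"
      unfolding \<Phi>_def by (intro continuous_intros)
    show "\<exists>u\<in>unit_square. \<exists>g\<in>torus_deck n k. motion g (\<Phi> u) = p" for p
    proof -
      define s where "s = (fst p + of_int k * snd p) / real n"
      define u where "u = (frac s, frac (snd p))"
      define g where "g = (False, int n * \<lfloor>s\<rfloor> - k * \<lfloor>snd p\<rfloor>, \<lfloor>snd p\<rfloor>)"
      have "u \<in> unit_square"
        using frac_lt_1[of s] frac_lt_1[of "snd p"] by (auto simp: u_def less_imp_le)
      moreover have "g \<in> torus_deck n k"
        by (simp add: g_def torus_deck_def)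
      moreover have "real n * s = fst p + of_int k * snd p"
        using n0 by (simp add: s_def)
      then have "motion g (\<Phi> u) = p"
        by (simp add: g_def \<Phi>_def u_def frac_def prod_eq_iff algebra_simps)
      ultimately show ?thesis by blast
    qed
    fix u u' :: "real \<times> real"
    have "(\<exists>g\<in>torus_deck n k. motion g (\<Phi> u) = \<Phi> u') \<longleftrightarrow>
        (\<exists>a b::int. fst u' = fst u + of_int a \<and> snd u' = snd u + of_int b)"
    proof
      assume "\<exists>g\<in>torus_deck n k. motion g (\<Phi> u) = \<Phi> u'"
      then obtain a b where d: "int n dvd a + k * b" and eq: "motion (False, a, b) (\<Phi> u) = \<Phi> u'"
        by (auto simp: torus_deck_def)
      obtain c where c: "a + k * b = int n * c" using d by blast
      have "real_of_int (a + k * b) = real_of_int (int n * c)" by (simp only: c)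
      then have c': "of_int a = real n * of_int c - of_int k * of_int b" by simp
      have e2: "snd u' = snd u + of_int b"
        using eq by (simp add: \<Phi>_def)
      have "real n * fst u' = real n * (fst u + of_int c)"
        using eq by (simp add: \<Phi>_def c' e2 algebra_simps)
      then have "fst u' = fst u + of_int c"
        using n0 by simp
      then show "\<exists>a b::int. fst u' = fst u + of_int a \<and> snd u' = snd u + of_int b"
        using e2 by blast
    next
      assume "\<exists>a b::int. fst u' = fst u + of_int a \<and> snd u' = snd u + of_int b"
      then obtain a b :: int where ab: "fst u' = fst u + of_int a" "snd u' = snd u + of_int b" by blast
      have "(False, int n * a - k * b, b) \<in> torus_deck n k"
        by (simp add: torus_deck_def)
      moreover have "motion (False, int n * a - k * b, b) (\<Phi> u) = \<Phi> u'"
        by (simp add: \<Phi>_def ab algebra_simps)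
      ultimately show "\<exists>g\<in>torus_deck n k. motion g (\<Phi> u) = \<Phi> u'" by blast
    qed
    then show "(cis (2 * pi * fst u), cis (2 * pi * snd u)) = (cis (2 * pi * fst u'), cis (2 * pi * snd u')) \<longleftrightarrow>
        (\<exists>g\<in>torus_deck n k. motion g (\<Phi> u) = \<Phi> u')"
      by (simp add: cis_2pi_eq_iff)
  qed
qed

lemma range_torus_label: "0 < n \<Longrightarrow> range (torus_label n k) = {..<n}"
proof -
  assume "0 < n"
  have "range (torus_label n k) = range (cyc n)"
  proof (intro subset_antisym subsetI)
    fix v
    assume "v \<in> range (cyc n)"
    then obtain a where "v = torus_label n k (a, 0)" by (auto simp: torus_label_def)
    then show "v \<in> range (torus_label n k)" by simp
  qed (auto simp: torus_label_def)
  then show ?thesis using range_cyc[OF \<open>0 < n\<close>] by simp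
qed

lemma torus_complex_vertex_transitive:
  assumes "0 < n"
  shows "vertex_transitive (torus_complex n k)"
  unfolding vertex_transitive_def torus_complex_def vertices_label_complex
proof (intro ballI)
  fix v w
  assume "v \<in> range (torus_label n k)" "w \<in> range (torus_label n k)"
  then obtain i j i' j' where v: "v = torus_label n k (i, j)" and w: "w = torus_label n k (i', j')"
    by auto
  have fin: "finite (range (torus_label n k))"
    by (simp add: range_torus_label[OF assms])
  define c where "c = (i' + k * j') - (i + k * j)"
  have "torus_label n k (i + c, j + 0) = torus_label n k (i' + c, j' + 0)"
    if "torus_label n k (i, j) = torus_label n k (i', j')" for i j i' j'
    using that assms by (simp add: torus_label_def cyc_eq_iff algebra_simps)
  then obtain f where f: "is_isomorphism (label_complex (torus_label n k)) (label_complex (torus_label n k)) f"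
    "\<And>i j. f (torus_label n k (i, j)) = torus_label n k (i + c, j + 0)"
    using label_complex_translation[OF fin, of c 0] by blast
  have "f v = w"
    unfolding v w f(2) by (simp add: torus_label_def c_def)
  then show "\<exists>f. is_isomorphism (label_complex (torus_label n k)) (label_complex (torus_label n k)) f \<and> f v = w"
    using f(1) by blast
qed

lemma torus_complex_weakly_regular:
  assumes k: "2 \<le> k" and n: "2 * k + 3 \<le> int n"
  shows "weakly_regular_triangulation (torus_complex n k) n torus"
proof -
  have "0 < n" using k n by linarith
  then show ?thesis
    using torus_complex_carrier[OF assms] torus_complex_vertex_transitive
    by (simp add: weakly_regular_triangulation_def triangulates_def torus_complex_def
        abstract_complex_label_complex vertices_label_complex range_torus_label)
qed

section \<open>Distinguishing the cyclic triangulations\<close>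

text \<open>In a closed surface whose vertices have degree six, this holds exactly for the pairs \<open>a\<close>, \<open>b\<close> at
distance three in the hexagonal link of \<open>v\<close>: they are neither equal nor adjacent in the link, and no
\<open>c\<close> is adjacent to both there. The formulation uses nothing but simplices, so isomorphisms preserve it.\<close>

definition opposite :: "'a set set \<Rightarrow> 'a \<Rightarrow> 'a \<Rightarrow> 'a \<Rightarrow> bool" where
  "opposite X v a b \<longleftrightarrow> v \<noteq> a \<and> v \<noteq> b \<and> {v, a} \<in> X \<and> {v, b} \<in> X \<and> {v, a, b} \<notin> X \<and>
     (\<forall>c. c \<noteq> v \<longrightarrow> {v, a, c} \<in> X \<longrightarrow> {v, c, b} \<notin> X)"

lemma opposite_isomorphism:
  assumes f: "is_isomorphism X Y f" and opp: "opposite X v a b"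
  shows "opposite Y (f v) (f a) (f b)"
proof -
  have inj: "inj_on f (vertices X)" and onto: "f ` vertices X = vertices Y"
    using f by (auto simp: is_isomorphism_def bij_betw_def)
  have simplex: "s \<in> X \<longleftrightarrow> f ` s \<in> Y" if "s \<subseteq> vertices X" for s
    using f that by (simp add: is_isomorphism_def)
  have V: "v \<in> vertices X" "a \<in> vertices X" "b \<in> vertices X"
    using opp by (auto simp: opposite_def vertices_def)
  have "{f v, f a} \<in> Y" "{f v, f b} \<in> Y" "{f v, f a, f b} \<notin> Y"
    using simplex[of "{v, a}"] simplex[of "{v, b}"] simplex[of "{v, a, b}"] opp V by (simp_all add: opposite_def)
  moreover have "f v \<noteq> f a" "f v \<noteq> f b"
    using inj_on_eq_iff[OF inj] V opp by (simp_all add: opposite_def)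
  moreover have "{f v, c', f b} \<notin> Y" if "c' \<noteq> f v" "{f v, f a, c'} \<in> Y" for c'
  proof -
    have "c' \<in> vertices Y" using that(2) unfolding vertices_def by (rule UnionI) simp
    then obtain c where c: "c \<in> vertices X" "c' = f c" using onto by blast
    then have "{v, a, c} \<in> X" "c \<noteq> v"
      using that simplex[of "{v, a, c}"] V by auto
    then have "{v, c, b} \<notin> X" using opp by (simp add: opposite_def)
    then show ?thesis using simplex[of "{v, c, b}"] V c by simp
  qed
  ultimately show ?thesis by (simp add: opposite_def)
qed

text \<open>The vertices of the two kinds of triangles relative to the lower left corner.\<close>

definition offsets :: "int \<Rightarrow> int set set" where
  "offsets k = {{0, 1, k + 1}, {0, k, k + 1}}"

text \<open>The differences along edges, listed in the cyclic order of the link: consecutive entries span a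
triangle with the centre.\<close>

definition steps :: "int \<Rightarrow> int set" where
  "steps k = {1, k + 1, k, -1, - k - 1, - k}"

lemma torus_label_kuhn_triangle:
  "torus_label n k ` kuhn_triangle up i j =
    (\<lambda>z. cyc n ((i + k * j) + z)) ` (if up then {0, k, k + 1} else {0, 1, k + 1})"
  by (cases up) (simp_all add: torus_label_def kuhn_triangle_def algebra_simps)

lemma torus_simplexI:
  assumes "D \<in> offsets k" "s \<noteq> {}" "s \<subseteq> (\<lambda>z. cyc n (w + z)) ` D"
  shows "s \<in> torus_complex n k"
proof -
  have "D = (if D = {0, k, k + 1} then {0, k, k + 1} else {0, 1, k + 1})"
    using assms(1) by (auto simp: offsets_def)
  then have "(\<lambda>z. cyc n (w + z)) ` D = torus_label n k ` kuhn_triangle (D = {0, k, k + 1}) w 0"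
    unfolding torus_label_kuhn_triangle by simp
  then show ?thesis
    unfolding torus_complex_def using assms(2,3)
    by (intro label_complexI[of s _ "D = {0, k, k + 1}" w 0]) simp_all
qed

lemma torus_simplexE:
  assumes "s \<in> torus_complex n k"
  obtains D w where "D = {0, 1, k + 1} \<or> D = {0, k, k + 1}" "\<And>a. a \<in> s \<Longrightarrow> \<exists>z\<in>D. a = cyc n (w + z)"
proof -
  obtain up i j where "s \<subseteq> torus_label n k ` kuhn_triangle up i j"
    using assms unfolding torus_complex_def label_complex_def by blast
  then have "s \<subseteq> (\<lambda>z. cyc n ((i + k * j) + z)) ` (if up then {0, k, k + 1} else {0, 1, k + 1})"
    unfolding torus_label_kuhn_triangle .
  then show thesis
    by (intro that[of "if up then {0, k, k + 1} else {0, 1, k + 1}" "i + k * j"]) auto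
qed

lemma torus_corner:
  assumes "D \<in> offsets k" "r \<in> D" "s \<in> D" "t \<in> D"
  shows "{cyc n v, cyc n (v + (s - r)), cyc n (v + (t - r))} \<in> torus_complex n k"
proof (rule torus_simplexI[OF assms(1)])
  have "cyc n v = cyc n (v - r + r)" "cyc n (v + (s - r)) = cyc n (v - r + s)"
    "cyc n (v + (t - r)) = cyc n (v - r + t)"
    by (simp_all add: algebra_simps)
  then show "{cyc n v, cyc n (v + (s - r)), cyc n (v + (t - r))} \<subseteq> (\<lambda>z. cyc n (v - r + z)) ` D"
    using assms(2-4) by blast
qed simp

lemma torus_edge_step:
  assumes "0 < n" "{cyc n v, cyc n a} \<in> torus_complex n k" "cyc n v \<noteq> cyc n a"
  shows "\<exists>d\<in>steps k. cyc n a = cyc n (v + d)"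
proof -
  obtain D w where D: "D = {0, 1, k + 1} \<or> D = {0, k, k + 1}"
    and sub: "\<And>b. b \<in> {cyc n v, cyc n a} \<Longrightarrow> \<exists>z\<in>D. b = cyc n (w + z)"
    using assms(2) by (rule torus_simplexE) blast
  obtain x where x: "x \<in> D" "cyc n v = cyc n (w + x)"
    using sub[of "cyc n v"] by auto
  obtain y where y: "y \<in> D" "cyc n a = cyc n (w + y)"
    using sub[of "cyc n a"] by auto
  have "cyc n a = cyc n (v + (y - x))"
    unfolding y(2) by (rule cyc_cong[OF assms(1) x(2)[symmetric]]) simp
  moreover have "y - x \<in> steps k"
  proof -
    have "x \<noteq> y" using assms(3) x(2) y(2) by auto
    from D show ?thesis
    proof
      assume "D = {0, 1, k + 1}"
      then have "x = 0 \<or> x = 1 \<or> x = k + 1" "y = 0 \<or> y = 1 \<or> y = k + 1"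
        using x(1) y(1) by simp_all
      then show ?thesis using \<open>x \<noteq> y\<close> unfolding steps_def insert_iff by (smt (verit))
    next
      assume "D = {0, k, k + 1}"
      then have "x = 0 \<or> x = k \<or> x = k + 1" "y = 0 \<or> y = k \<or> y = k + 1"
        using x(1) y(1) by simp_all
      then show ?thesis using \<open>x \<noteq> y\<close> unfolding steps_def insert_iff by (smt (verit))
    qed
  qed
  ultimately show ?thesis by blast
qed

text \<open>The unit edge lies in no triangles but the expected two. An edge of a triangle with offsets \<open>x\<close>,
\<open>y\<close> has length \<open>1\<close> modulo \<open>n\<close> only if \<open>y = x + 1\<close>, because \<open>\<bar>1 + x - y\<bar> \<le> k + 2 < n\<close>; and
\<open>k \<ge> 2\<close> leaves one such edge in either kind of triangle.\<close>

lemma torus_triangle_on_unit_edge: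
  assumes k: "2 \<le> k" and n: "2 * k + 3 \<le> int n"
    and tri: "{cyc n v, cyc n (v + 1), c} \<in> torus_complex n k"
  shows "\<exists>x\<in>{0, 1, k + 1, - k}. c = cyc n (v + x)"
proof -
  have "0 < n" using k n by linarith
  obtain D w where D: "D = {0, 1, k + 1} \<or> D = {0, k, k + 1}"
    and sub: "\<And>b. b \<in> {cyc n v, cyc n (v + 1), c} \<Longrightarrow> \<exists>z\<in>D. b = cyc n (w + z)"
    using tri by (rule torus_simplexE) blast
  obtain x where x: "x \<in> D" "cyc n v = cyc n (w + x)"
    using sub[of "cyc n v"] by auto
  obtain y where y: "y \<in> D" "cyc n (v + 1) = cyc n (w + y)"
    using sub[of "cyc n (v + 1)"] by auto
  obtain z where z: "z \<in> D" "c = cyc n (w + z)"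
    using sub[of c] by auto
  have "int n dvd v + 1 - (w + y)" "int n dvd v - (w + x)"
    using x(2) y(2) by (simp_all only: cyc_eq_iff[OF \<open>0 < n\<close>])
  then have "int n dvd (v + 1 - (w + y)) - (v - (w + x))"
    by (rule dvd_diff)
  then have "int n dvd 1 + x - y" by (simp add: algebra_simps)
  then have y_x: "1 + x - y = 0" if "\<bar>1 + x - y\<bar> < int n"
    using that by (rule dvd_abs_less_imp_zero)
  from D have "z - x \<in> {0, 1, k + 1, - k}"
  proof
    assume "D = {0, 1, k + 1}"
    then have "x = 0 \<or> x = 1 \<or> x = k + 1" "y = 0 \<or> y = 1 \<or> y = k + 1" "z = 0 \<or> z = 1 \<or> z = k + 1"
      using x(1) y(1) z(1) by simp_all
    moreover from this have "x = 0" using y_x k n by linarith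
    ultimately show ?thesis by auto
  next
    assume "D = {0, k, k + 1}"
    then have "x = 0 \<or> x = k \<or> x = k + 1" "y = 0 \<or> y = k \<or> y = k + 1" "z = 0 \<or> z = k \<or> z = k + 1"
      using x(1) y(1) z(1) by simp_all
    moreover from this have "x = k" using y_x k n by linarith
    ultimately show ?thesis by auto
  qed
  moreover have "c = cyc n (v + (z - x))"
    unfolding z(2) by (rule cyc_cong[OF \<open>0 < n\<close> x(2)[symmetric]]) simp
  ultimately show ?thesis by blast
qed

lemma opposite_unit_steps:
  assumes k: "2 \<le> k" and n: "2 * k + 3 \<le> int n"
  shows "opposite (torus_complex n k) (cyc n v) (cyc n (v + 1)) (cyc n (v - 1))"
proof -
  have "0 < n" using k n by linarith
  have ne: "cyc n (v + x) \<noteq> cyc n (v + y)" if "x \<noteq> y" "\<bar>x - y\<bar> < int n" for x y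
    using that dvd_abs_less_imp_zero[of "int n" "x - y"] \<open>0 < n\<close> by (auto simp: cyc_eq_iff)
  note tri = torus_triangle_on_unit_edge[OF k n]
  have edge: "{cyc n w, cyc n (w + 1)} \<in> torus_complex n k" for w
    using torus_corner[of "{0, 1, k + 1}" k 0 0 1 n w] by (simp add: offsets_def)
  have "cyc n v \<noteq> cyc n (v + 1)" "cyc n v \<noteq> cyc n (v - 1)"
    using ne[of 0 1] ne[of 0 "-1"] k n by simp_all
  moreover have "{cyc n v, cyc n (v + 1)} \<in> torus_complex n k" "{cyc n v, cyc n (v - 1)} \<in> torus_complex n k"
    using edge[of v] edge[of "v - 1"] by (simp_all add: insert_commute)
  moreover have "{cyc n v, cyc n (v + 1), cyc n (v - 1)} \<notin> torus_complex n k"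
  proof
    assume "{cyc n v, cyc n (v + 1), cyc n (v - 1)} \<in> torus_complex n k"
    then have "\<exists>x\<in>{0, 1, k + 1, - k}. cyc n (v - 1) = cyc n (v + x)"
      by (rule tri)
    then obtain x where x: "x \<in> {0, 1, k + 1, - k}" "cyc n (v - 1) = cyc n (v + x)"
      by blast
    have "-1 \<noteq> x" "\<bar>-1 - x\<bar> < int n"
      using x(1) k n by auto
    then show False
      using ne[of "-1" x] x(2) by simp
  qed
  moreover have "{cyc n v, c, cyc n (v - 1)} \<notin> torus_complex n k"
    if "c \<noteq> cyc n v" "{cyc n v, cyc n (v + 1), c} \<in> torus_complex n k" for c
  proof
    assume "{cyc n v, c, cyc n (v - 1)} \<in> torus_complex n k"
    then have "{cyc n (v - 1), cyc n (v - 1 + 1), c} \<in> torus_complex n k"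
      by (simp add: insert_commute)
    from tri[OF this] obtain y where y: "y \<in> {0, 1, k + 1, - k}" "c = cyc n (v - 1 + y)"
      by blast
    have y': "c = cyc n (v + (y - 1))"
      unfolding y(2) by (simp add: algebra_simps)
    from tri[OF that(2)] obtain x where x: "x \<in> {0, 1, k + 1, - k}" "c = cyc n (v + x)"
      by blast
    have "x \<noteq> 0" "y \<noteq> 1"
      using that(1) x(2) y' by auto
    then have "x = 1 \<or> x = k + 1 \<or> x = - k" "y = 0 \<or> y = k + 1 \<or> y = - k"
      using x(1) y(1) by simp_all
    then have "x \<noteq> y - 1" "\<bar>x - (y - 1)\<bar> < int n"
      using k n by linarith+
    then show False
      using ne[of x "y - 1"] x(2) y' by simp
  qed
  ultimately show ?thesis by (simp add: opposite_def)
qed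

text \<open>If \<open>b\<close> were not the reflection of \<open>a\<close> in \<open>v\<close>, then in the hexagon around \<open>v\<close> it would equal \<open>a\<close>,
be next to it, or share a neighbour with it, and each of these contradicts the definition of
\<open>opposite\<close> because the six expected triangles around \<open>v\<close> exist.\<close>

lemma opposite_imp_straight:
  assumes k: "2 \<le> k" and n: "2 * k + 3 \<le> int n"
    and opp: "opposite (torus_complex n k) (cyc n v) (cyc n a) (cyc n b)"
  shows "int n dvd a + b - 2 * v"
proof -
  have "0 < n" using k n by linarith
  define P where "P d e \<longleftrightarrow> {cyc n v, cyc n (v + d), cyc n (v + e)} \<in> torus_complex n k" for d e
  obtain d where d: "d \<in> steps k" "cyc n a = cyc n (v + d)"
    using torus_edge_step[OF \<open>0 < n\<close>, of v a k] opp by (auto simp: opposite_def)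
  obtain e where e: "e \<in> steps k" "cyc n b = cyc n (v + e)"
    using torus_edge_step[OF \<open>0 < n\<close>, of v b k] opp by (auto simp: opposite_def)
  have sym: "P x y \<longleftrightarrow> P y x" for x y
    by (simp add: P_def insert_commute)
  have corner: "P (s - r) (t - r)" if "D \<in> offsets k" "r \<in> D" "s \<in> D" "t \<in> D" for D r s t
    unfolding P_def using that by (rule torus_corner)
  have O: "{0, 1, k + 1} \<in> offsets k" "{0, k, k + 1} \<in> offsets k"
    by (simp_all add: offsets_def)
  have P: "P 1 (k + 1)" "P (k + 1) k" "P k (-1)" "P (-1) (- k - 1)" "P (- k - 1) (- k)" "P (- k) 1"
    using corner[OF O(1), of 0 1 "k + 1"] corner[OF O(2), of 0 "k + 1" k] corner[OF O(1), of 1 "k + 1" 0]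
      corner[OF O(2), of "k + 1" k 0] corner[OF O(1), of "k + 1" 0 1] corner[OF O(2), of k 0 "k + 1"]
    by simp_all
  have diag: "P x x" if "P x y" for x y
  proof -
    have "{cyc n v, cyc n (v + x), cyc n (v + x)} \<subseteq> {cyc n v, cyc n (v + x), cyc n (v + y)}"
      by simp
    moreover have "abstract_complex (torus_complex n k)"
      by (simp add: torus_complex_def abstract_complex_label_complex)
    ultimately show ?thesis
      using that unfolding P_def abstract_complex_def by (meson insert_not_empty)
  qed
  have no: "\<not> P d e"
    using opp d(2) e(2) by (simp add: opposite_def P_def)
  have no2: "\<not> (P d c \<and> P c e)" if "c \<in> steps k" for c
  proof -
    have "c \<noteq> 0" "\<bar>c\<bar> < int n" using that k n by (auto simp: steps_def)
    then have "cyc n (v + c) \<noteq> cyc n v"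
      using dvd_abs_less_imp_zero[of "int n" c] \<open>0 < n\<close> by (auto simp: cyc_eq_iff)
    then show ?thesis
      using opp d(2) e(2) by (auto simp: opposite_def P_def)
  qed
  have P': "P (k + 1) 1" "P k (k + 1)" "P (-1) k" "P (- k - 1) (-1)" "P (- k) (- k - 1)" "P 1 (- k)"
    using P sym by blast+
  have "e = - d"
    using d(1) e(1) no no2[of 1] no2[of "k + 1"] no2[of k] no2[of "-1"] no2[of "- k - 1"] no2[of "- k"]
      P P' P[THEN diag]
    unfolding steps_def insert_iff empty_iff simp_thms
    by (elim disjE; hypsubst; simp)
  then have "cyc n b = cyc n (v - d)" using e by simp
  then have "int n dvd b - (v - d)" "int n dvd a - (v + d)"
    using d(2) by (simp_all only: cyc_eq_iff[OF \<open>0 < n\<close>])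
  then have "int n dvd (b - (v - d)) + (a - (v + d))"
    by (rule dvd_add)
  then show ?thesis by (simp add: algebra_simps)
qed

text \<open>By straightness the labels \<open>g i\<close> of the images of \<open>0, 1, 2, \<dots>\<close> satisfy
\<open>g (i + 1) - g i = g i - g (i - 1)\<close> modulo \<open>n\<close>, so they form an arithmetic progression. The edges from
\<open>0\<close> to \<open>1\<close>, \<open>k\<close> and \<open>k + 1\<close> must go to edges.\<close>

lemma torus_isomorphism_multiplier:
  assumes k: "2 \<le> k" "2 * k + 3 \<le> int n" and k': "2 \<le> k'" "2 * k' + 3 \<le> int n"
    and iso: "isomorphic (torus_complex n k) (torus_complex n k')"
  shows "\<exists>u\<in>steps k'. (\<exists>d\<in>steps k'. int n dvd k * u - d) \<and> (\<exists>d\<in>steps k'. int n dvd (k + 1) * u - d)"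
proof -
  have "0 < n" using k by linarith
  have V: "vertices (torus_complex n j) = {..<n}" for j
    by (simp add: torus_complex_def vertices_label_complex range_torus_label \<open>0 < n\<close>)
  obtain f where f: "is_isomorphism (torus_complex n k) (torus_complex n k') f"
    using iso by (auto simp: isomorphic_def)
  have bij: "bij_betw f {..<n} {..<n}"
    using f by (simp add: is_isomorphism_def V)
  define g where "g i = int (f (cyc n i))" for i
  have cyc_V: "cyc n i < n" for i
    using range_cyc[OF \<open>0 < n\<close>] by blast
  then have "f (cyc n i) < n" for i
    using bij_betwE[OF bij] by blast
  then have g: "f (cyc n i) = cyc n (g i)" for i
    by (simp add: g_def cyc_def)
  define u where "u = g 1 - g 0"
  have straight: "int n dvd g (i + 1) + g (i - 1) - 2 * g i" for i
    using opposite_imp_straight[OF k'] opposite_isomorphism[OF f opposite_unit_steps[OF k, of i]]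
    by (simp add: g)
  have linear: "int n dvd g (int j) - g 0 - int j * u" for j
  proof (induction j rule: less_induct)
    case (less j)
    consider "j = 0" | "j = 1" | j' where "j = Suc (Suc j')"
      by (metis One_nat_def not0_implies_Suc)
    then show ?case
    proof cases
      case 3
      have "int n dvd g (int (Suc j')) - g 0 - int (Suc j') * u" "int n dvd g (int j') - g 0 - int j' * u"
        using less[of "Suc j'"] less[of j'] 3 by simp_all
      from dvd_diff[OF dvd_add[OF straight dvd_mult[OF this(1), of 2]] this(2)]
      have "int n dvd (g (int (Suc j') + 1) + g (int (Suc j') - 1) - 2 * g (int (Suc j')))
          + 2 * (g (int (Suc j')) - g 0 - int (Suc j') * u) - (g (int j') - g 0 - int j' * u)" .
      also have "\<dots> = g (int j) - g 0 - int j * u"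
        by (simp add: 3 algebra_simps)
      finally show ?thesis .
    qed (simp_all add: u_def)
  qed
  have image: "\<exists>d\<in>steps k'. int n dvd g x - g 0 - d"
    if "x = 1 \<or> x = k \<or> x = k + 1" for x
  proof -
    have edge: "{cyc n 0, cyc n x} \<in> torus_complex n k"
      using that torus_corner[of "{0, 1, k + 1}" k 0 0 x n 0] torus_corner[of "{0, k, k + 1}" k 0 0 x n 0]
      by (auto simp: offsets_def)
    have ne: "cyc n 0 \<noteq> cyc n x"
    proof -
      have "x \<noteq> 0" "\<bar>x\<bar> < int n" using that k by auto
      then show ?thesis
        using dvd_abs_less_imp_zero[of "int n" x] \<open>0 < n\<close> by (auto simp: cyc_eq_iff)
    qed
    have "{cyc n 0, cyc n x} \<subseteq> vertices (torus_complex n k)"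
      using cyc_V by (simp add: V)
    then have "f ` {cyc n 0, cyc n x} \<in> torus_complex n k'"
      using f edge unfolding is_isomorphism_def by blast
    then have "{cyc n (g 0), cyc n (g x)} \<in> torus_complex n k'"
      by (simp add: g)
    moreover have "cyc n (g 0) \<noteq> cyc n (g x)"
      using ne inj_on_eq_iff[OF bij_betw_imp_inj_on[OF bij], of "cyc n 0" "cyc n x"] cyc_V
      unfolding g[symmetric] by simp
    ultimately obtain d where "d \<in> steps k'" "cyc n (g x) = cyc n (g 0 + d)"
      using torus_edge_step[OF \<open>0 < n\<close>] by blast
    then show ?thesis
      using cyc_eq_iff[OF \<open>0 < n\<close>] by (auto simp: algebra_simps)
  qed
  obtain d where d: "d \<in> steps k'" "int n dvd u - d"
    using image[of 1] by (auto simp: u_def)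
  have mult: "\<exists>e\<in>steps k'. int n dvd x * d - e" if "x = k \<or> x = k + 1" for x
  proof -
    have "\<exists>e\<in>steps k'. int n dvd g x - g 0 - e"
      by (rule image) (use that in blast)
    then obtain e where e: "e \<in> steps k'" "int n dvd g x - g 0 - e"
      by blast
    have "x = int (nat x)" using that k by auto
    then have "int n dvd g x - g 0 - x * u"
      using linear[of "nat x"] by metis
    from dvd_diff[OF dvd_diff[OF this e(2)] dvd_mult[OF d(2), of "- x"]]
    have "int n dvd (g x - g 0 - x * u) - (g x - g 0 - e) - (- x) * (u - d)" .
    then have "int n dvd - (x * d - e)" by (simp add: algebra_simps)
    then have "int n dvd x * d - e" by (simp only: dvd_minus_iff)
    then show ?thesis using e(1) by blast
  qed
  show ?thesis using d(1) mult[of k] mult[of "k + 1"] by blast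
qed

text \<open>A multiplier \<open>u\<close> has \<open>2 u\<close> among the steps modulo \<open>n\<close>. Over the integers it never is,
and the discrepancy is at most \<open>11\<close>, except that it can be \<open>12\<close> for \<open>u = \<plusminus> 4\<close>. In that case
\<open>n = 12\<close>, and \<open>3 u\<close>, which must be a step as well, is zero modulo \<open>n\<close>.\<close>

lemma not_isomorphic_torus_2_3:
  assumes "12 \<le> n"
  shows "\<not> isomorphic (torus_complex n 2) (torus_complex n 3)"
proof
  assume "isomorphic (torus_complex n 2) (torus_complex n 3)"
  then obtain u d e where u: "u \<in> steps 3" and d: "d \<in> steps 3" "int n dvd 2 * u - d"
    and e: "e \<in> steps 3" "int n dvd (2 + 1) * u - e"
    using torus_isomorphism_multiplier[of 2 n 3] assms by auto
  have "2 * u - d \<noteq> 0" "\<bar>2 * u - d\<bar> < 12 \<or> \<bar>u\<bar> = 4 \<and> \<bar>2 * u - d\<bar> = 12"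
    using u d(1) by (auto simp: steps_def)
  then have "n = 12" "u = 4 \<or> u = -4"
    using dvd_abs_less_imp_zero[OF d(2)] assms by linarith+
  then show False
    using e by (auto simp: steps_def)
qed

lemma not_isomorphic_torus_2_4:
  assumes "18 \<le> n"
  shows "\<not> isomorphic (torus_complex n 2) (torus_complex n 4)"
proof
  assume "isomorphic (torus_complex n 2) (torus_complex n 4)"
  then obtain u d where u: "u \<in> steps 4" and d: "d \<in> steps 4" "int n dvd 2 * u - d"
    using torus_isomorphism_multiplier[of 2 n 4] assms by auto
  have "2 * u - d \<noteq> 0" "\<bar>2 * u - d\<bar> < 18"
    using u d(1) by (auto simp: steps_def)
  then show False
    using dvd_abs_less_imp_zero[OF d(2)] assms by linarith
qed

text \<open>Here \<open>3 u\<close> can be a step only by a discrepancy of \<open>19\<close>, which requires \<open>n = 19\<close>, or of \<open>20\<close>, where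
\<open>u = \<plusminus> 5\<close> and \<open>n = 20\<close>; in the latter case \<open>4 u\<close> is zero modulo \<open>n\<close>.\<close>

lemma not_isomorphic_torus_3_4:
  assumes "18 \<le> n" "n \<noteq> 19"
  shows "\<not> isomorphic (torus_complex n 3) (torus_complex n 4)"
proof
  assume "isomorphic (torus_complex n 3) (torus_complex n 4)"
  then obtain u d e where u: "u \<in> steps 4" and d: "d \<in> steps 4" "int n dvd 3 * u - d"
    and e: "e \<in> steps 4" "int n dvd (3 + 1) * u - e"
    using torus_isomorphism_multiplier[of 3 n 4] assms by auto
  have "3 * u - d \<noteq> 0" and z: "\<bar>3 * u - d\<bar> < 18 \<or> \<bar>3 * u - d\<bar> = 19 \<or> \<bar>u\<bar> = 5 \<and> \<bar>3 * u - d\<bar> = 20"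
    using u d(1) by (auto simp: steps_def)
  then have "int n \<le> \<bar>3 * u - d\<bar>"
    using dvd_abs_less_imp_zero[OF d(2)] by linarith
  then have n: "n = 18 \<or> n = 20" and "\<not> \<bar>3 * u - d\<bar> < 18"
    using z assms by linarith+
  have dvd: "int n dvd z" if "\<bar>3 * u - d\<bar> = z" for z
    using d(2) unfolding that[symmetric] by simp
  have "\<not> int n dvd 19" using n by auto
  then have "\<bar>3 * u - d\<bar> \<noteq> 19"
    using dvd by blast
  then have "\<bar>u\<bar> = 5" "\<bar>3 * u - d\<bar> = 20"
    using z \<open>\<not> \<bar>3 * u - d\<bar> < 18\<close> by blast+
  then have "\<bar>u\<bar> = 5" "int n dvd 20"
    using dvd by blast+
  then have "n = 20" "u = 5 \<or> u = -5"
    using n by auto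
  then show False
    using e by (auto simp: steps_def)
qed

lemma not_isomorphic_torus_19:
  "\<not> isomorphic (torus_complex 19 2) (torus_complex 19 7)"
  "\<not> isomorphic (torus_complex 19 3) (torus_complex 19 7)"
proof -
  show "\<not> isomorphic (torus_complex 19 2) (torus_complex 19 7)"
    using torus_isomorphism_multiplier[of 2 19 7] by (auto simp: steps_def)
  show "\<not> isomorphic (torus_complex 19 3) (torus_complex 19 7)"
    using torus_isomorphism_multiplier[of 3 19 7] by (auto simp: steps_def)
qed

section \<open>A family of triangulations of the Klein bottle\<close>

text \<open>In equilateral coordinates, \<open>2 i - j\<close> is twice the position of \<open>(i, j)\<close> along its row. It is
invariant under \<open>(i, j) \<mapsto> (i + 2, j + 4)\<close> and grows by \<open>2 m + 1\<close> under the glide reflection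
\<open>(i, j) \<mapsto> (i - j + m + 1, 1 - j)\<close>. These motions preserve the classes \<open>{0, 1}\<close> and \<open>{2, 3}\<close> of rows
modulo \<open>4\<close>, which are told apart by \<open>j div 2 mod 2\<close>.\<close>

definition klein_label :: "int \<Rightarrow> int \<times> int \<Rightarrow> nat" where
  "klein_label m q = nat ((2 * m + 1) * (snd q div 2 mod 2) + (2 * fst q - snd q) mod (2 * m + 1))"

definition klein_deck :: "int \<Rightarrow> (bool \<times> int \<times> int) set" where
  "klein_deck m = {(False, 2 * b + a * (2 * m + 1), 4 * b) | a b. True} \<union>
     {(True, m + 1 + a * (2 * m + 1) + 2 * b, 1 + 4 * b) | a b. True}"

definition klein_complex :: "int \<Rightarrow> nat set set" where
  "klein_complex m = label_complex (klein_label m)"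

lemma klein_deck_cases:
  assumes "g \<in> klein_deck m"
  obtains a b where "g = (False, 2 * b + a * (2 * m + 1), 4 * b)"
    | a b where "g = (True, m + 1 + a * (2 * m + 1) + 2 * b, 1 + 4 * b)"
  using assms unfolding klein_deck_def by auto

lemma klein_label_eq_iff:
  assumes "0 \<le> m"
  shows "klein_label m (i, j) = klein_label m (i', j') \<longleftrightarrow>
    j div 2 mod 2 = j' div 2 mod 2 \<and> 2 * m + 1 dvd (2 * i' - j') - (2 * i - j)"
proof -
  define N where "N = 2 * m + 1"
  have "0 < N" using assms by (simp add: N_def)
  have split: "(N * c + x mod N) div N = c" "(N * c + x mod N) mod N = x mod N" for c x
    using \<open>0 < N\<close> by simp_all
  have "klein_label m (i, j) = klein_label m (i', j') \<longleftrightarrow>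
      N * (j div 2 mod 2) + (2 * i - j) mod N = N * (j' div 2 mod 2) + (2 * i' - j') mod N"
    unfolding klein_label_def fst_conv snd_conv N_def[symmetric]
    using \<open>0 < N\<close> by (intro eq_nat_nat_iff) simp_all
  also have "\<dots> \<longleftrightarrow> j div 2 mod 2 = j' div 2 mod 2 \<and> (2 * i' - j') mod N = (2 * i - j) mod N"
    using split by metis
  finally show ?thesis by (simp add: mod_eq_dvd_iff N_def)
qed

text \<open>Between points of one orbit, the parity of the row decides which kind of motion is needed: rows of
equal parity differ by a multiple of \<open>4\<close>, rows of different parity are exchanged by a glide reflection.
For the star condition, a glide reflection within a star changes the row by \<open>\<plusminus> 1\<close>, and then the first
coordinate by \<open>m + 1\<close> or \<open>m\<close> modulo \<open>2 m + 1\<close>, which is too far for \<open>m \<ge> 2\<close>.\<close>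

lemma klein_motion_quotient:
  assumes m: "2 \<le> m"
  shows "motion_quotient (klein_label m) (klein_deck m)"
proof
  fix q q' :: "int \<times> int"
  obtain i j i' j' where q: "q = (i, j)" "q' = (i', j')" by (cases q, cases q')
  have "klein_label m q = klein_label m q' \<longleftrightarrow>
      j div 2 mod 2 = j' div 2 mod 2 \<and> 2 * m + 1 dvd (2 * i' - j') - (2 * i - j)"
    unfolding q using m by (intro klein_label_eq_iff) simp
  also have "\<dots> \<longleftrightarrow> (\<exists>g\<in>klein_deck m. motion g q = q')"
  proof
    assume "j div 2 mod 2 = j' div 2 mod 2 \<and> 2 * m + 1 dvd (2 * i' - j') - (2 * i - j)"
    then obtain t where row: "j div 2 mod 2 = j' div 2 mod 2"
      and t: "(2 * i' - j') - (2 * i - j) = (2 * m + 1) * t"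
      by blast
    have "(\<exists>b. j' = j + 4 * b) \<or> (\<exists>b. j' = 1 + 4 * b - j)"
      using row by presburger
    then show "\<exists>g\<in>klein_deck m. motion g q = q'"
    proof (elim disjE exE)
      fix b
      assume b: "j' = j + 4 * b"
      have "even ((2 * m + 1) * t)"
        unfolding t[symmetric] b by simp
      then obtain a where a: "t = 2 * a" by auto
      have "i' = i + (2 * b + a * (2 * m + 1))"
        using t unfolding a b by (simp add: algebra_simps)
      then have "motion (False, 2 * b + a * (2 * m + 1), 4 * b) q = q'"
        by (simp add: q b)
      moreover have "(False, 2 * b + a * (2 * m + 1), 4 * b) \<in> klein_deck m"
        by (auto simp: klein_deck_def)
      ultimately show ?thesis by blast
    next
      fix b
      assume b: "j' = 1 + 4 * b - j"
      have "odd ((2 * m + 1) * t)"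
        unfolding t[symmetric] b by simp
      then have "odd t" by simp
      then obtain a where a: "t = 2 * a + 1" by (elim oddE)
      have "i' = i - j + (m + 1 + a * (2 * m + 1) + 2 * b)"
        using t unfolding a b by (simp add: algebra_simps)
      then have "motion (True, m + 1 + a * (2 * m + 1) + 2 * b, 1 + 4 * b) q = q'"
        by (simp add: q b)
      moreover have "(True, m + 1 + a * (2 * m + 1) + 2 * b, 1 + 4 * b) \<in> klein_deck m"
        by (auto simp: klein_deck_def)
      ultimately show ?thesis by blast
    qed
  next
    assume "\<exists>g\<in>klein_deck m. motion g q = q'"
    then obtain g where g: "g \<in> klein_deck m" "motion g q = q'" by blast
    from g(1) show "j div 2 mod 2 = j' div 2 mod 2 \<and> 2 * m + 1 dvd (2 * i' - j') - (2 * i - j)"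
    proof (cases rule: klein_deck_cases)
      case (1 a b)
      have j': "j' = j + 4 * b" and i': "i' = i + (2 * b + a * (2 * m + 1))"
        using g(2) by (simp_all add: 1 q)
      have "(2 * i' - j') - (2 * i - j) = (2 * m + 1) * (2 * a)"
        unfolding i' j' by (simp add: algebra_simps)
      moreover have "j' div 2 = j div 2 + 2 * b"
        unfolding j' by presburger
      ultimately show ?thesis by simp
    next
      case (2 a b)
      have j': "j' = 1 + 4 * b - j" and i': "i' = i - j + (m + 1 + a * (2 * m + 1) + 2 * b)"
        using g(2) by (simp_all add: 2 q)
      have "(2 * i' - j') - (2 * i - j) = (2 * m + 1) * (2 * a + 1)"
        unfolding i' j' by (simp add: algebra_simps)
      moreover have "j' div 2 = 2 * b - j div 2"
        unfolding j' by presburger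
      moreover have "(2 * b - x) mod 2 = x mod 2" for x
        by presburger
      ultimately show ?thesis by simp
    qed
  qed
  finally show "klein_label m q = klein_label m q' \<longleftrightarrow> (\<exists>g\<in>klein_deck m. motion g q = q')" .
next
  fix g and q c :: "int \<times> int"
  assume g: "g \<in> klein_deck m" and star: "q \<in> star c" "motion g q \<in> star c"
  obtain i j where q: "q = (i, j)" by (cases q)
  define N where "N = 2 * m + 1"
  have N: "a * N \<ge> N \<or> a = 0 \<and> a * N = 0 \<or> a * N \<le> - N" for a
  proof -
    have "a * N \<ge> 1 * N" if "a \<ge> 1"
      using that m by (intro mult_right_mono) (simp_all add: N_def)
    moreover have "a * N \<le> (-1) * N" if "a \<le> -1"
      using that m by (intro mult_right_mono) (simp_all add: N_def)
    moreover have "a * N = 0" if "a = 0" using that by simp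
    ultimately show ?thesis by linarith
  qed
  from g show "motion g q = q"
  proof (cases rule: klein_deck_cases)
    case (1 a b)
    have bounds: "\<bar>2 * b + a * N\<bar> \<le> 2" "\<bar>4 * b\<bar> \<le> 2"
      using star_difference[OF star] by (simp_all add: 1 q N_def)
    then have "b = 0" by linarith
    moreover have "a = 0"
      using N[of a] bounds \<open>b = 0\<close> m N_def by linarith
    ultimately show ?thesis by (simp add: 1 q)
  next
    case (2 a b)
    define di dj where "di = m + 1 + a * N + 2 * b - j" and "dj = 1 + 4 * b - 2 * j"
    have "motion g q = (i + di, j + dj)"
      by (simp add: 2 q di_def dj_def N_def)
    then have bounds: "\<bar>di\<bar> \<le> 2" "\<bar>dj\<bar> \<le> 2" "\<bar>di - dj\<bar> \<le> 2"
      using star_difference[OF star] by (simp_all add: q)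
    have "dj = 1 \<or> dj = -1"
      using bounds(2) unfolding dj_def by presburger
    then have False
    proof
      assume dj: "dj = 1"
      then have "di = m + 1 + a * N" by (simp add: di_def dj_def)
      then show False
        using N[of a] bounds dj m N_def by linarith
    next
      assume dj: "dj = -1"
      then have "di = m + a * N" by (simp add: di_def dj_def)
      then show False
        using N[of a] bounds dj m N_def by linarith
    qed
    then show ?thesis ..
  qed
qed

text \<open>The gluing of the vertical sides, made compatible with the gluing of the horizontal sides: for
\<open>b = \<plusminus> 1\<close> both points are corners of the square, and all four corners are identified.\<close>

lemma equivclp_klein_glue_reflected:
  assumes "v \<in> {0..1}" "v' \<in> {0..1}" "v' = 1 - v + of_int b"
  shows "equivclp klein_glue (0, v) (1, v')"
proof -
  have glue: "equivclp klein_glue (0, t) (1, 1 - t)" "equivclp klein_glue (t, 0) (t, 1)"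
    if "t \<in> {0..1}" for t
    using that unfolding klein_glue_def by (intro r_into_equivclp; blast)+
  have "of_int b \<ge> (-1::real)" "of_int b \<le> (1::real)"
    using assms by auto
  then have "b \<in> {-1, 0, 1}"
    by auto
  then consider "b = 0" | "b = 1" | "b = -1" by blast
  then show ?thesis
  proof cases
    case 1
    then show ?thesis using glue(1)[of v] assms by simp
  next
    case 2
    then have "v = 1" "v' = 1" using assms by auto
    then show ?thesis
      using equivclp_trans[of klein_glue "(0, 1)" "(1, 0)" "(1, 1)"] glue(1)[of 1] glue(2)[of 1] by simp
  next
    case 3
    then have "v = 0" "v' = 0" using assms by auto
    then show ?thesis
      using equivclp_trans[of klein_glue "(0, 0)" "(1, 1)" "(1, 0)"] glue(1)[of 0]
        equivclp_sym[OF glue(2)[of 1]] by simp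
  qed
qed

lemma klein_complex_carrier:
  assumes m: "2 \<le> m"
  shows "top_of_set (geometric_carrier (klein_complex m)) homeomorphic_space klein_bottle"
proof -
  interpret motion_quotient "klein_label m" "klein_deck m"
    using m by (rule klein_motion_quotient)
  define M where "M = real_of_int m + 1 / 2"
  have M: "M > 0"
    using m by (simp add: M_def)
  \<comment> \<open>The glide axis is the line \<open>y = 1 / 2\<close>, at half the height of the square; the period of four rows has
height \<open>1\<close>, and a glide has length \<open>M\<close> along the row. Half of \<open>y\<close> is added to convert the position along
the row into the first lattice coordinate.\<close>
  define y where "y v = 4 * v - 3 / 2" for v :: real
  define \<Phi> where "\<Phi> u = (M * fst u + y (snd u) / 2, y (snd u))" for u :: "real \<times> real"
  have deckF: "(False, 2 * b + a * (2 * m + 1), 4 * b) \<in> klein_deck m"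
    and deckT: "(True, m + 1 + a * (2 * m + 1) + 2 * b, 1 + 4 * b) \<in> klein_deck m" for a b
    by (auto simp: klein_deck_def)
  have motF: "motion (False, 2 * b + a * (2 * m + 1), 4 * b) (\<Phi> (s, t)) = \<Phi> (s + 2 * of_int a, t + of_int b)"
    for a b :: int and s t :: real
    by (simp add: \<Phi>_def y_def M_def field_simps)
  have motT: "motion (True, m + 1 + a * (2 * m + 1) + 2 * b, 1 + 4 * b) (\<Phi> (s, t)) =
      \<Phi> (s + 1 + 2 * of_int a, 1 - t + of_int b)"
    for a b :: int and s t :: real
    by (simp add: \<Phi>_def y_def M_def field_simps)
  have inj: "u = u'" if "\<Phi> u = \<Phi> u'" for u u'
    using that M by (auto simp: \<Phi>_def y_def prod_eq_iff)
  show ?thesis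
    unfolding klein_complex_def klein_bottle_def
  proof (rule geometric_carrier_homeomorphic[OF _ _ quotient_map_quotient_topology])
    show "continuous_on unit_square \<Phi>"
      unfolding \<Phi>_def y_def by (intro continuous_intros) auto
    show "\<exists>u\<in>unit_square. \<exists>g\<in>klein_deck m. motion g (\<Phi> u) = p" for p
    proof -
      define t where "t = (snd p + 3 / 2) / 4"
      define s where "s = (fst p - snd p / 2) / M"
      have "y t = snd p"
        by (simp add: y_def t_def field_simps)
      then have p: "\<Phi> (s, t) = p"
        using M by (simp add: \<Phi>_def s_def prod_eq_iff)
      have fr: "0 \<le> frac s" "frac s \<le> 1" "0 \<le> frac t" "frac t \<le> 1"
        using frac_lt_1[of s] frac_lt_1[of t] by (auto simp: less_imp_le)
      have st: "s = frac s + of_int \<lfloor>s\<rfloor>" "t = frac t + of_int \<lfloor>t\<rfloor>"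
        by (simp_all add: frac_def)
      show ?thesis
      proof (cases "even \<lfloor>s\<rfloor>")
        case True
        then obtain a where a: "\<lfloor>s\<rfloor> = 2 * a" by auto
        have "motion (False, 2 * \<lfloor>t\<rfloor> + a * (2 * m + 1), 4 * \<lfloor>t\<rfloor>) (\<Phi> (frac s, frac t)) = p"
          unfolding motF using st a p by simp
        moreover have "(frac s, frac t) \<in> unit_square" using fr by simp
        ultimately show ?thesis using deckF by blast
      next
        case False
        then obtain a where a: "\<lfloor>s\<rfloor> = 2 * a + 1" by (elim oddE)
        have "motion (True, m + 1 + a * (2 * m + 1) + 2 * \<lfloor>t\<rfloor>, 1 + 4 * \<lfloor>t\<rfloor>) (\<Phi> (frac s, 1 - frac t)) = p"
          unfolding motT using st a p by (simp add: algebra_simps)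
        moreover have "(frac s, 1 - frac t) \<in> unit_square" using fr by simp
        ultimately show ?thesis using deckT by blast
      qed
    qed
    fix u u' :: "real \<times> real"
    assume u: "u \<in> unit_square" "u' \<in> unit_square"
    have "{q. equivclp klein_glue u q} = {q. equivclp klein_glue u' q} \<longleftrightarrow> equivclp klein_glue u u'"
      by (metis (no_types, lifting) Collect_cong equivclp_refl equivclp_sym equivclp_trans mem_Collect_eq)
    also have "\<dots> \<longleftrightarrow> (\<exists>g\<in>klein_deck m. motion g (\<Phi> u) = \<Phi> u')"
    proof
      assume "equivclp klein_glue u u'"
      then have "barycentric_map (klein_label m) (\<Phi> u) = barycentric_map (klein_label m) (\<Phi> u')"
      proof (induction rule: equivclp_induct)
        case (step p q)
        have "barycentric_map (klein_label m) (\<Phi> p) = barycentric_map (klein_label m) (\<Phi> q)"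
          if "klein_glue p q" for p q
        proof -
          obtain t where "p = (t, 0) \<and> q = (t, 1) \<or> p = (0, t) \<and> q = (1, 1 - t)"
            using \<open>klein_glue p q\<close> unfolding klein_glue_def by blast
          then show ?thesis
          proof
            assume "p = (t, 0) \<and> q = (t, 1)"
            then show ?thesis
              using barycentric_map_motion[OF deckF[of 1 0], of "\<Phi> p"] motF[of 1 0 t 0] by simp
          next
            assume "p = (0, t) \<and> q = (1, 1 - t)"
            then show ?thesis
              using barycentric_map_motion[OF deckT[of 0 0], of "\<Phi> p"] motT[of 0 0 0 t] by simp
          qed
        qed
        then show ?case using step by metis
      qed simp
      then show "\<exists>g\<in>klein_deck m. motion g (\<Phi> u) = \<Phi> u'"
        by (simp add: barycentric_map_eq_iff)
    next
      assume "\<exists>g\<in>klein_deck m. motion g (\<Phi> u) = \<Phi> u'"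
      then obtain g where g: "g \<in> klein_deck m" "motion g (\<Phi> u) = \<Phi> u'" by blast
      obtain s t s' t' where st: "u = (s, t)" "u' = (s', t')" by (cases u, cases u')
      have range: "0 \<le> s" "s \<le> 1" "0 \<le> t" "t \<le> 1" "0 \<le> s'" "s' \<le> 1" "0 \<le> t'" "t' \<le> 1"
        using u by (auto simp: st)
      from g(1) show "equivclp klein_glue u u'"
      proof (cases rule: klein_deck_cases)
        case (1 a b)
        have "(s + 2 * of_int a, t + of_int b) = (s', t')"
          using g(2) unfolding 1 st motF by (rule inj)
        then have s': "s' = s + 2 * of_int a" and t': "t' = t + of_int b" by simp_all
        have "a = 0" using s' range by linarith
        have "b = 0 \<or> b = 1 \<or> b = -1" using t' range by linarith
        then show ?thesis
        proof (elim disjE)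
          assume "b = 0"
          then show ?thesis using s' t' \<open>a = 0\<close> by (simp add: st)
        next
          assume "b = 1"
          then have "t = 0" "t' = 1" using t' range by auto
          then have "klein_glue u u'" using s' \<open>a = 0\<close> range by (auto simp: klein_glue_def st)
          then show ?thesis by (rule r_into_equivclp)
        next
          assume "b = -1"
          then have "t = 1" "t' = 0" using t' range by auto
          then have "klein_glue u' u" using s' \<open>a = 0\<close> range by (auto simp: klein_glue_def st)
          then show ?thesis by (rule converse_r_into_equivclp)
        qed
      next
        case (2 a b)
        have "(s + 1 + 2 * of_int a, 1 - t + of_int b) = (s', t')"
          using g(2) unfolding 2 st motT by (rule inj)
        then have s': "s' = s + 1 + 2 * of_int a" and t': "t' = 1 - t + of_int b" by simp_all
        have "a = 0 \<or> a = -1" using s' range by linarith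
        then show ?thesis
        proof
          assume "a = 0"
          then have "s = 0" "s' = 1" using s' range by auto
          moreover have "equivclp klein_glue (0, t) (1, t')"
            by (rule equivclp_klein_glue_reflected[of t t' b]) (use t' range in auto)
          ultimately show ?thesis
            unfolding st by simp
        next
          assume "a = -1"
          then have "s = 1" "s' = 0" using s' range by auto
          moreover have "equivclp klein_glue (0, t') (1, t)"
            by (rule equivclp_klein_glue_reflected[of t' t b]) (use t' range in auto)
          ultimately show ?thesis
            unfolding st by (simp only: equivclp_sym)
        qed
      qed
    qed
    finally show "{q. equivclp klein_glue u q} = {q. equivclp klein_glue u' q} \<longleftrightarrow>
      (\<exists>g\<in>klein_deck m. motion g (\<Phi> u) = \<Phi> u')" .
  qed
qed

lemma range_klein_label:
  assumes "0 \<le> m"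
  shows "range (klein_label m) = {..<nat (2 * (2 * m + 1))}"
proof (intro subset_antisym subsetI)
  define N where "N = 2 * m + 1"
  have "0 < N" using assms by (simp add: N_def)
  {
    fix x
    assume "x \<in> range (klein_label m)"
    then obtain q where x: "x = nat (N * (snd q div 2 mod 2) + (2 * fst q - snd q) mod N)"
      unfolding klein_label_def N_def by blast
    have "N * (snd q div 2 mod 2) \<le> N * 1"
      using \<open>0 < N\<close> by (intro mult_left_mono) auto
    moreover have "(2 * fst q - snd q) mod N < N" using \<open>0 < N\<close> by simp
    ultimately have "N * (snd q div 2 mod 2) + (2 * fst q - snd q) mod N < 2 * N"
      by linarith
    then show "x \<in> {..<nat (2 * (2 * m + 1))}"
      unfolding x N_def[symmetric] lessThan_iff using \<open>0 < N\<close> by (subst nat_mono_iff) simp_all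
  next
    fix x
    assume "x \<in> {..<nat (2 * (2 * m + 1))}"
    then have x: "int x < N * 2" unfolding N_def by (simp add: zless_nat_eq_int_zless)
    define c r where "c = int x div N" and "r = int x mod N"
    have "N * c + r = int x" by (simp add: c_def r_def)
    moreover have r: "0 \<le> r" "r < N" using \<open>0 < N\<close> by (simp_all add: r_def)
    ultimately have "N * c < N * 2"
      using x by linarith
    then have c: "0 \<le> c" "c < 2"
      using \<open>0 < N\<close> by (simp_all add: c_def pos_imp_zdiv_nonneg_iff)
    define j where "j = 2 * c + r mod 2"
    define i where "i = (r + j) div 2"
    have "2 * i - j = r" unfolding i_def j_def by presburger
    moreover have "j div 2 mod 2 = c" unfolding j_def using c by presburger
    ultimately have "klein_label m (i, j) = nat (N * c + r)"
      using r by (simp add: klein_label_def N_def)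
    also have "\<dots> = x" by (simp add: c_def r_def)
    finally show "x \<in> range (klein_label m)" by (metis rangeI)
  }
qed

text \<open>A shift by \<open>c\<close> along the rows changes \<open>2 i - j\<close> by \<open>2 c\<close>, and \<open>m + 1\<close> is the inverse of \<open>2\<close> modulo
\<open>2 m + 1\<close>; so shifts connect any two labels in one class of rows. The point reflection
\<open>(i, j) \<mapsto> (c - i, 3 - j)\<close> exchanges the two classes.\<close>

lemma klein_complex_vertex_transitive:
  assumes m: "0 \<le> m"
  shows "vertex_transitive (klein_complex m)"
  unfolding vertex_transitive_def klein_complex_def vertices_label_complex
proof (intro ballI)
  note eq_iff = klein_label_eq_iff[OF m]
  have fin: "finite (range (klein_label m))"
    by (simp add: range_klein_label[OF m])
  fix v w
  assume "v \<in> range (klein_label m)" "w \<in> range (klein_label m)"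
  then obtain i j i' j' where v: "v = klein_label m (i, j)" and w: "w = klein_label m (i', j')"
    by auto
  show "\<exists>f. is_isomorphism (label_complex (klein_label m)) (label_complex (klein_label m)) f \<and> f v = w"
  proof (cases "j div 2 mod 2 = j' div 2 mod 2")
    case True
    define c where "c = (m + 1) * ((2 * i' - j') - (2 * i - j))"
    have "klein_label m (i + c, j + 0) = klein_label m (i' + c, j' + 0)"
      if "klein_label m (i, j) = klein_label m (i', j')" for i j i' j'
      using that unfolding eq_iff by (simp add: algebra_simps)
    then obtain f where f: "is_isomorphism (label_complex (klein_label m)) (label_complex (klein_label m)) f"
      "\<And>i j. f (klein_label m (i, j)) = klein_label m (i + c, j + 0)"
      using label_complex_translation[OF fin, of c 0] by blast
    have "(2 * i' - j') - (2 * (i + c) - (j + 0)) = (2 * m + 1) * - ((2 * i' - j') - (2 * i - j))"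
      by (simp add: c_def algebra_simps)
    then have "f v = w"
      unfolding v w f(2) eq_iff using True by (simp only: add_0_right dvd_triv_left simp_thms)
    then show ?thesis using f(1) by blast
  next
    case False
    define c where "c = (m + 1) * ((2 * i' - j') + (2 * i - j) + 3)"
    have row: "(3 - j) div 2 mod 2 = 1 - j div 2 mod 2" for j :: int
    proof -
      have "(3 - j) div 2 = 1 - j div 2" by presburger
      moreover have "(1 - x) mod 2 = 1 - x mod 2" for x :: int by presburger
      ultimately show ?thesis by simp
    qed
    have "klein_label m (c - i, 3 - j) = klein_label m (c - i', 3 - j')"
      if "klein_label m (i, j) = klein_label m (i', j')" for i j i' j'
    proof -
      have "(2 * (c - i') - (3 - j')) - (2 * (c - i) - (3 - j)) = - ((2 * i' - j') - (2 * i - j))"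
        by simp
      then show ?thesis
        using that unfolding eq_iff row by (metis dvd_minus_iff)
    qed
    then obtain f where f: "is_isomorphism (label_complex (klein_label m)) (label_complex (klein_label m)) f"
      "\<And>i j. f (klein_label m (i, j)) = klein_label m (c - i, 3 - j)"
      using label_complex_point_reflection[OF fin, of c 3] by blast
    have "(2 * i' - j') - (2 * (c - i) - (3 - j)) = (2 * m + 1) * - ((2 * i' - j') + (2 * i - j) + 3)"
      by (simp add: c_def algebra_simps)
    moreover have "(3 - j) div 2 mod 2 = j' div 2 mod 2"
    proof -
      have "x div 2 mod 2 = 0 \<or> x div 2 mod 2 = 1" for x :: int by presburger
      from this[of j] this[of j'] show ?thesis unfolding row using False by auto
    qed
    ultimately have "f v = w"
      unfolding v w f(2) eq_iff by (simp only: dvd_triv_left simp_thms)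
    then show ?thesis using f(1) by blast
  qed
qed

lemma klein_complex_weakly_regular:
  assumes "2 \<le> m"
  shows "weakly_regular_triangulation (klein_complex (int m)) (4 * m + 2) klein_bottle"
proof -
  have m: "0 \<le> int m" "2 \<le> int m" using assms by simp_all
  have "nat (2 * (2 * int m + 1)) = 4 * m + 2" by simp
  then show ?thesis
    using klein_complex_carrier[OF m(2)] klein_complex_vertex_transitive[OF m(1)]
    by (simp add: weakly_regular_triangulation_def triangulates_def klein_complex_def
        abstract_complex_label_complex vertices_label_complex range_klein_label[OF m(1)])
qed

section \<open>The three families\<close>

theorem theorem3:
  shows "(\<forall>n\<ge>12::nat. \<exists>(X :: nat set set) (Y :: nat set set).
            weakly_regular_triangulation X n torus \<and>
            weakly_regular_triangulation Y n torus \<and>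
            \<not> isomorphic X Y) \<and>
         (\<forall>n\<ge>18::nat. \<exists>(X :: nat set set) (Y :: nat set set) (Z :: nat set set).
            weakly_regular_triangulation X n torus \<and>
            weakly_regular_triangulation Y n torus \<and>
            weakly_regular_triangulation Z n torus \<and>
            \<not> isomorphic X Y \<and> \<not> isomorphic X Z \<and> \<not> isomorphic Y Z) \<and>
         (\<forall>m\<ge>2::nat. \<exists>X :: nat set set.
            weakly_regular_triangulation X (4 * m + 2) klein_bottle)"
proof (intro conjI allI impI)
  fix n :: nat
  assume n: "12 \<le> n"
  show "\<exists>(X :: nat set set) (Y :: nat set set).
            weakly_regular_triangulation X n torus \<and>
            weakly_regular_triangulation Y n torus \<and>
            \<not> isomorphic X Y"
    using torus_complex_weakly_regular[of 2 n] torus_complex_weakly_regular[of 3 n]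
      not_isomorphic_torus_2_3[OF n] n
    by (intro exI[of _ "torus_complex n 2"] exI[of _ "torus_complex n 3"]) simp
next
  fix n :: nat
  assume n: "18 \<le> n"
  define k :: int where "k = (if n = 19 then 7 else 4)"
  have k: "2 \<le> k" "2 * k + 3 \<le> int n"
    using n by (simp_all add: k_def)
  have "\<not> isomorphic (torus_complex n 2) (torus_complex n k)"
    "\<not> isomorphic (torus_complex n 3) (torus_complex n k)"
    using not_isomorphic_torus_19 not_isomorphic_torus_2_4[OF n] not_isomorphic_torus_3_4[OF n]
    by (simp_all add: k_def)
  then show "\<exists>(X :: nat set set) (Y :: nat set set) (Z :: nat set set).
            weakly_regular_triangulation X n torus \<and>
            weakly_regular_triangulation Y n torus \<and>
            weakly_regular_triangulation Z n torus \<and>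
            \<not> isomorphic X Y \<and> \<not> isomorphic X Z \<and> \<not> isomorphic Y Z"
    using torus_complex_weakly_regular[of 2 n] torus_complex_weakly_regular[of 3 n]
      torus_complex_weakly_regular[OF k] not_isomorphic_torus_2_3[of n] n
    by (intro exI[of _ "torus_complex n 2"] exI[of _ "torus_complex n 3"]
        exI[of _ "torus_complex n k"]) simp
next
  fix m :: nat
  assume "2 \<le> m"
  then show "\<exists>X :: nat set set. weakly_regular_triangulation X (4 * m + 2) klein_bottle"
    using klein_complex_weakly_regular by blast
qed

end
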